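(* Let $k\ge 0$ be an integer. There exists a dominant polynomial map $f:\mathbb{C}^2\to\mathbb{C}^2$ with $\mu_f=k+1$ and such that $\mathbb{C}^2\setminus f(\mathbb{C}^2)$ has at least one isolated point if and only if $k\ge 1$.
   Context: A polynomial map $f:\mathbb{C}^2\to\mathbb{C}^2$ is dominant if $f(\mathbb{C}^2)$ is dense in $\mathbb{C}^2$; $\mu_f$ denotes the number of preimages under $f$ of a generic point of $\mathbb{C}^2$. *)

theory Defs
  imports "HOL-Analysis.Analysis"
begin

definition poly2 :: "(complex \<times> complex \<Rightarrow> complex) \<Rightarrow> bool" where
  "poly2 P \<longleftrightarrow> (\<exists>(N::nat) (c::nat \<Rightarrow> nat \<Rightarrow> complex).
      \<forall>x y. P (x, y) = (\<Sum>i\<le>N. \<Sum>j\<le>N. c i j * x ^ i * y ^ j))"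

definition poly_map2 :: "(complex \<times> complex \<Rightarrow> complex \<times> complex) \<Rightarrow> bool" where
  "poly_map2 f \<longleftrightarrow> poly2 (\<lambda>z. fst (f z)) \<and> poly2 (\<lambda>z. snd (f z))"

definition dominant :: "(complex \<times> complex \<Rightarrow> complex \<times> complex) \<Rightarrow> bool" where
  "dominant f \<longleftrightarrow> closure (range f) = UNIV"

definition generic_fibre_card :: "(complex \<times> complex \<Rightarrow> complex \<times> complex) \<Rightarrow> nat \<Rightarrow> bool" where
  "generic_fibre_card f m \<longleftrightarrow> (\<exists>g. poly2 g \<and> (\<exists>z. g z \<noteq> 0) \<and>
      (\<forall>q. g q \<noteq> 0 \<longrightarrow> finite (f -` {q}) \<and> card (f -` {q}) = m))"

definition isolated_point_of :: "'a::metric_space \<Rightarrow> 'a set \<Rightarrow> bool" where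
  "isolated_point_of p S \<longleftrightarrow> p \<in> S \<and> (\<exists>e>0. ball p e \<inter> S = {p})"

end

theory Submission
  imports Defs "HOL-Complex_Analysis.Complex_Analysis"
    "HOL-Computational_Algebra.Field_as_Ring"
    "HOL-Computational_Algebra.Polynomial_Factorial"
    "HOL-Computational_Algebra.Fundamental_Theorem_Algebra"
begin

text \<open>
  For \<open>k \<ge> 1\<close> the map \<open>(x, y) \<mapsto> (xy - 1, x + (xy - 1) y\<^sup>k)\<close> omits the origin but no other point near it:
  over \<open>(a, b)\<close> with \<open>a (1 + a) \<noteq> 0\<close> the fibre is given by \<open>x\<^sup>k (x - b) + a (1 + a)\<^sup>k = 0\<close>, which has
  \<open>k + 1\<close> roots, all nonzero, while \<open>(0, b)\<close> with \<open>b \<noteq> 0\<close> is the image of \<open>(b, 1 / b)\<close>.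

  For \<open>k = 0\<close> the generically defined inverse of \<open>f\<close> is algebraic and single-valued, hence rational; its
  components are quotients \<open>A / B\<close> in lowest terms. If \<open>B p = 0\<close>, then arbitrarily close to \<open>p\<close> there are
  points \<open>q \<noteq> p\<close> with \<open>B q = 0 \<noteq> A q\<close>, and these are not values of \<open>f\<close>, because \<open>A (f z) = x B (f z)\<close>.
  So if the complement of the image has an isolated point \<open>p\<close>, the inverse is regular at \<open>p\<close>, and by
  continuity \<open>p\<close> is a value of \<open>f\<close> after all.
\<close>

subsection \<open>Polynomial functions of two variables\<close>

declare split_paired_All [simp del] split_paired_Ex [simp del]

text \<open>Polynomials are encoded in C[x][y]: the coefficients are polynomials in the first
  coordinate, the outer variable is the second. This makes the gcd theory of a factorial ring
  available next to evaluation at points.\<close>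

definition bieval :: "complex poly poly \<Rightarrow> complex \<times> complex \<Rightarrow> complex" where
  "bieval F q = poly (poly F [:snd q:]) (fst q)"

lemma bieval_add [simp]: "bieval (F + H) q = bieval F q + bieval H q"
  and bieval_diff [simp]: "bieval (F - H) q = bieval F q - bieval H q"
  and bieval_mult [simp]: "bieval (F * H) q = bieval F q * bieval H q"
  and bieval_power [simp]: "bieval (F ^ n) q = bieval F q ^ n"
  and bieval_0 [simp]: "bieval 0 q = 0"
  and bieval_const [simp]: "bieval [:p:] q = poly p (fst q)"
  by (simp_all add: bieval_def)

lemma bieval_monom [simp]: "bieval (monom (monom c i) j) (x, y) = c * x ^ i * y ^ j"
  by (simp add: bieval_def poly_monom)

lemma bieval_sum: "bieval (\<Sum>i\<in>I. F i) q = (\<Sum>i\<in>I. bieval (F i) q)"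
  by (simp add: bieval_def poly_sum)

lemma poly_eq_sum_atMost:
  fixes p :: "'a::comm_semiring_1 poly"
  assumes "degree p \<le> N"
  shows "poly p x = (\<Sum>i\<le>N. coeff p i * x ^ i)"
  unfolding poly_altdef using assms
  by (intro sum.mono_neutral_left) (auto simp: coeff_eq_0)

lemma bieval_eq_double_sum:
  assumes "degree F \<le> N" "\<And>j. degree (coeff F j) \<le> N"
  shows "bieval F (x, y) = (\<Sum>i\<le>N. \<Sum>j\<le>N. coeff (coeff F j) i * x ^ i * y ^ j)"
proof -
  have "bieval F (x, y) = (\<Sum>j\<le>N. poly (coeff F j) x * y ^ j)"
    using assms(1) by (simp add: bieval_def poly_eq_sum_atMost[of F N] poly_sum)
  also have "\<dots> = (\<Sum>j\<le>N. \<Sum>i\<le>N. coeff (coeff F j) i * x ^ i * y ^ j)"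
    by (simp add: poly_eq_sum_atMost[OF assms(2)] sum_distrib_right)
  also have "\<dots> = (\<Sum>i\<le>N. \<Sum>j\<le>N. coeff (coeff F j) i * x ^ i * y ^ j)"
    by (rule sum.swap)
  finally show ?thesis .
qed

lemma bidegree_bound:
  fixes F :: "'a::zero poly poly"
  shows "\<exists>N. degree F \<le> N \<and> (\<forall>j. degree (coeff F j) \<le> N)"
proof -
  define N where "N = degree F + (\<Sum>j\<le>degree F. degree (coeff F j))"
  have "degree (coeff F j) \<le> N" for j
  proof (cases "j \<le> degree F")
    case True
    then have "degree (coeff F j) \<le> (\<Sum>j\<le>degree F. degree (coeff F j))"
      by (intro member_le_sum) auto
    then show ?thesis by (simp add: N_def)
  qed (simp add: coeff_eq_0)
  then show ?thesis by (intro exI[of _ N]) (simp add: N_def)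
qed

lemma poly2_iff_bieval: "poly2 P \<longleftrightarrow> (\<exists>F. \<forall>q. P q = bieval F q)"
proof
  assume "poly2 P"
  then obtain N :: nat and c where c: "\<And>x y. P (x, y) = (\<Sum>i\<le>N. \<Sum>j\<le>N. c i j * x ^ i * y ^ j)"
    unfolding poly2_def by blast
  have "P q = bieval (\<Sum>i\<le>N. \<Sum>j\<le>N. monom (monom (c i j) i) j) q" for q
    by (cases q) (simp add: c bieval_sum)
  then show "\<exists>F. \<forall>q. P q = bieval F q" by blast
next
  assume "\<exists>F. \<forall>q. P q = bieval F q"
  then obtain F where F: "\<And>q. P q = bieval F q" by blast
  obtain N where "degree F \<le> N" "\<And>j. degree (coeff F j) \<le> N" using bidegree_bound by blast
  then show "poly2 P" unfolding poly2_def F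
    by (intro exI[of _ N] exI[of _ "\<lambda>i j. coeff (coeff F j) i"]) (simp add: bieval_eq_double_sum)
qed

lemma poly2D: "poly2 P \<Longrightarrow> \<exists>F. P = bieval F"
  by (auto simp: poly2_iff_bieval fun_eq_iff)

named_theorems poly2_intros

lemma poly2_bieval: "poly2 (bieval F)"
  unfolding poly2_iff_bieval by blast

lemma poly2_const [poly2_intros, simp]: "poly2 (\<lambda>q. c)"
  unfolding poly2_iff_bieval by (intro exI[of _ "[:[:c:]:]"]) simp

lemma poly2_fst [poly2_intros, simp]: "poly2 fst"
  unfolding poly2_iff_bieval by (intro exI[of _ "[:[:0, 1:]:]"]) simp

lemma poly2_snd [poly2_intros, simp]: "poly2 snd"
  unfolding poly2_iff_bieval by (intro exI[of _ "[:0, 1:]"]) (simp add: bieval_def)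

lemma poly2_add [poly2_intros]:
  assumes "poly2 P" "poly2 Q" shows "poly2 (\<lambda>q. P q + Q q)"
proof -
  obtain F H where "P = bieval F" "Q = bieval H"
    using poly2D[OF assms(1)] poly2D[OF assms(2)] by blast
  then show ?thesis unfolding poly2_iff_bieval by (intro exI[of _ "F + H"]) simp
qed

lemma poly2_mult [poly2_intros]:
  assumes "poly2 P" "poly2 Q" shows "poly2 (\<lambda>q. P q * Q q)"
proof -
  obtain F H where "P = bieval F" "Q = bieval H"
    using poly2D[OF assms(1)] poly2D[OF assms(2)] by blast
  then show ?thesis unfolding poly2_iff_bieval by (intro exI[of _ "F * H"]) simp
qed

lemma poly2_diff [poly2_intros]:
  assumes "poly2 P" "poly2 Q" shows "poly2 (\<lambda>q. P q - Q q)"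
proof -
  obtain F H where "P = bieval F" "Q = bieval H"
    using poly2D[OF assms(1)] poly2D[OF assms(2)] by blast
  then show ?thesis unfolding poly2_iff_bieval by (intro exI[of _ "F - H"]) simp
qed

lemma poly2_power [poly2_intros]: "poly2 P \<Longrightarrow> poly2 (\<lambda>q. P q ^ n)"
  by (induction n) (auto intro: poly2_intros)

lemma poly2_sum [poly2_intros]: "(\<And>i. i \<in> I \<Longrightarrow> poly2 (P i)) \<Longrightarrow> poly2 (\<lambda>q. \<Sum>i\<in>I. P i q)"
  by (induction I rule: infinite_finite_induct) (auto intro: poly2_intros)

lemma poly2_compose:
  assumes "poly2 c" "poly2 P" "poly2 Q"
  shows "poly2 (\<lambda>z. c (P z, Q z))"
proof -
  obtain N :: nat and d where "\<And>x y. c (x, y) = (\<Sum>i\<le>N. \<Sum>j\<le>N. d i j * x ^ i * y ^ j)"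
    using assms(1) unfolding poly2_def by blast
  then show ?thesis using assms(2,3) by (simp only:) (intro poly2_intros)
qed

lemma poly2_compose_map:
  assumes "poly2 c" "poly_map2 f"
  shows "poly2 (\<lambda>z. c (f z))"
  using poly2_compose[OF assms(1), of "\<lambda>z. fst (f z)" "\<lambda>z. snd (f z)"] assms(2)
  by (simp add: poly_map2_def)

lemma continuous_on_poly2 [continuous_intros]:
  assumes "poly2 P" "continuous_on S u"
  shows "continuous_on S (\<lambda>x. P (u x))"
proof -
  obtain N :: nat and d where d: "\<And>x y. P (x, y) = (\<Sum>i\<le>N. \<Sum>j\<le>N. d i j * x ^ i * y ^ j)"
    using assms(1) unfolding poly2_def by blast
  have "P (u x) = (\<Sum>i\<le>N. \<Sum>j\<le>N. d i j * fst (u x) ^ i * snd (u x) ^ j)" for x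
    using d[of "fst (u x)" "snd (u x)"] by simp
  then show ?thesis by (simp only:) (intro continuous_intros assms(2))
qed

lemma continuous_on_poly_map2:
  assumes "poly_map2 f"
  shows "continuous_on S f"
proof -
  have "continuous_on S (\<lambda>z. (fst (f z), snd (f z)))"
    using assms unfolding poly_map2_def
    by (intro continuous_on_Pair continuous_on_poly2[where u = "\<lambda>z. z"] continuous_on_id) auto
  then show ?thesis by simp
qed

section \<open>Zero sets of polynomials: identity theorem, density, dominance\<close>

text \<open>For each \<open>b\<close> in \<open>T\<close> the polynomial in the first variable has
  infinitely many roots, so it is zero. Hence \<open>F\<close>, as a polynomial over C[x], has
  infinitely many constant roots.\<close>

lemma bieval_eq_0_on_infinite_product:
  assumes "infinite S" "infinite T" "\<And>a b. a \<in> S \<Longrightarrow> b \<in> T \<Longrightarrow> bieval F (a, b) = 0"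
  shows "F = 0"
proof -
  have "poly F [:b:] = 0" if "b \<in> T" for b
  proof (rule ccontr)
    assume "poly F [:b:] \<noteq> 0"
    then have "finite {a. poly (poly F [:b:]) a = 0}" by (rule poly_roots_finite)
    moreover have "S \<subseteq> {a. poly (poly F [:b:]) a = 0}" using assms(3) that by (auto simp: bieval_def)
    ultimately show False using assms(1) finite_subset by blast
  qed
  then have "(\<lambda>b. [:b:]) ` T \<subseteq> {p. poly F p = 0}" by auto
  moreover have "infinite ((\<lambda>b. [:b:]) ` T)"
    using assms(2) by (subst finite_image_iff) (auto simp: inj_on_def)
  ultimately show ?thesis using poly_roots_finite finite_subset by blast
qed

lemma bieval_eq_0_iff: "(\<forall>q. bieval F q = 0) \<longleftrightarrow> F = 0"
  using bieval_eq_0_on_infinite_product[of UNIV UNIV F] by (auto simp: infinite_UNIV_char_0)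

text \<open>C[x][y] is an integral domain, and nonzero polynomials are nonzero as functions. Serves
  to cancel factors in polynomial identities.\<close>

lemma poly2_mult_nonzero:
  assumes "poly2 P" "poly2 Q" "\<exists>q. P q \<noteq> 0" "\<exists>q. Q q \<noteq> 0"
  shows "\<exists>q. P q * Q q \<noteq> 0"
proof -
  obtain F H where FH: "P = bieval F" "Q = bieval H"
    using poly2D[OF assms(1)] poly2D[OF assms(2)] by blast
  then have "F \<noteq> 0" "H \<noteq> 0" using assms(3,4) by auto
  then show ?thesis using bieval_eq_0_iff[of "F * H"] by (auto simp: FH)
qed

lemma infinite_ball_complex: "e > 0 \<Longrightarrow> infinite (ball (a::complex) e)"
  using uncountable_ball uncountable_infinite by blast

text \<open>Every ball contains a product of two smaller discs, which are infinite, so a polynomial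
  vanishing on it is zero.\<close>

lemma poly2_nonzero_dense:
  assumes "poly2 P" "\<exists>q. P q \<noteq> 0"
  shows "closure {q. P q \<noteq> 0} = UNIV"
proof -
  obtain F where F: "P = bieval F" using poly2D[OF assms(1)] by blast
  have "\<exists>q\<in>{q. P q \<noteq> 0}. dist q p < e" if "e > 0" for p e
  proof (rule ccontr)
    assume neg: "\<not> ?thesis"
    obtain a b where p: "p = (a, b)" by force
    have "bieval F (x, y) = 0" if xy: "x \<in> ball a (e/2)" "y \<in> ball b (e/2)" for x y
    proof -
      have "dist (x, y) p \<le> dist x a + dist y b"
        unfolding p dist_Pair_Pair by (rule sqrt_sum_squares_le_sum) auto
      also have "\<dots> < e" using xy by (simp add: dist_commute)
      finally show ?thesis using neg F by auto
    qed
    then have "F = 0"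
      using infinite_ball_complex[of "e/2"] that
      by (intro bieval_eq_0_on_infinite_product[of "ball a (e/2)" "ball b (e/2)"]) simp_all
    then show False using assms(2) F by simp
  qed
  then show ?thesis by (auto simp: closure_approachable)
qed

text \<open>The set where \<open>c\<close> does not vanish is open; if nonempty, it would meet the
  dense range. In other words, the components of a dominant map are algebraically
  independent.\<close>

lemma poly2_vanishing_on_range:
  assumes "poly2 c" "dominant f" "\<And>z. c (f z) = 0"
  shows "c q = 0"
proof (rule ccontr)
  assume "c q \<noteq> 0"
  have "open {q. c q \<noteq> 0}"
    using assms(1) by (intro open_Collect_neq continuous_on_poly2[where u = "\<lambda>z. z"]) auto
  moreover have "range f \<inter> {q. c q \<noteq> 0} = {}" using assms(3) by auto
  ultimately have "closure (range f) \<inter> {q. c q \<noteq> 0} = {}"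
    by (metis inf_commute open_Int_closure_eq_empty)
  then show False using assms(2) \<open>c q \<noteq> 0\<close> by (cases q) (auto simp: dominant_def)
qed

subsection \<open>Algebraic dependence over the components of a dominant map\<close>

text \<open>Gaussian elimination, by induction on the equations: a nonzero entry of the new equation
  serves as pivot and removes one unknown together with one equation.\<close>

lemma homogeneous_system_nontrivial_solution:
  fixes M :: "'i \<Rightarrow> 'j \<Rightarrow> 'a::field"
  assumes "finite I" "finite J" "card I < card J"
  shows "\<exists>c. (\<exists>j\<in>J. c j \<noteq> 0) \<and> (\<forall>i\<in>I. (\<Sum>j\<in>J. M i j * c j) = 0)"
  using assms
proof (induction I arbitrary: J M rule: finite_induct)
  case empty
  then obtain j where "j \<in> J" by fastforce
  then show ?case by (intro exI[of _ "\<lambda>_. 1"]) auto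
next
  case (insert i I)
  show ?case
  proof (cases "\<forall>j\<in>J. M i j = 0")
    case True
    have "card I < card J" using insert by simp
    then obtain c where "\<exists>j\<in>J. c j \<noteq> 0" "\<forall>i\<in>I. (\<Sum>j\<in>J. M i j * c j) = 0"
      using insert.IH[OF insert.prems(1)] by blast
    then show ?thesis using True by (intro exI[of _ c]) simp
  next
    case False
    then obtain j0 where j0: "j0 \<in> J" "M i j0 \<noteq> 0" by blast
    define J' where "J' = J - {j0}"
    have J': "finite J'" "card I < card J'" "J = insert j0 J'" "j0 \<notin> J'"
      using insert j0 by (auto simp: J'_def)
    \<comment> \<open>The coefficients after the unknown \<open>j0\<close> has been eliminated by
      means of equation \<open>i\<close>.\<close>
    define M' where "M' = (\<lambda>i' j. M i' j - M i' j0 * M i j / M i j0)"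
    obtain c where c: "\<exists>j\<in>J'. c j \<noteq> 0" "\<forall>i\<in>I. (\<Sum>j\<in>J'. M' i j * c j) = 0"
      using insert.IH[OF J'(1,2), of M'] by blast
    define s where "s = (\<Sum>j\<in>J'. M i j * c j)"
    define c' where "c' = c(j0 := - s / M i j0)"
    have sum': "(\<Sum>j\<in>J. M i' j * c' j) = (\<Sum>j\<in>J'. M i' j * c j) - M i' j0 * s / M i j0" for i'
    proof -
      have "(\<Sum>j\<in>J'. M i' j * c' j) = (\<Sum>j\<in>J'. M i' j * c j)"
        using J'(4) by (intro sum.cong) (auto simp: c'_def)
      then show ?thesis using J'(1,3,4) by (simp add: c'_def)
    qed
    have "(\<Sum>j\<in>J. M i' j * c' j) = 0" if "i' \<in> insert i I" for i'
    proof (cases "i' = i")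
      case True
      then show ?thesis using j0 by (simp add: sum' s_def)
    next
      case False
      then have "0 = (\<Sum>j\<in>J'. M' i' j * c j)" using c(2) that by simp
      also have "\<dots> = (\<Sum>j\<in>J'. M i' j * c j - M i' j0 / M i j0 * (M i j * c j))"
        by (intro sum.cong) (auto simp: M'_def algebra_simps)
      also have "\<dots> = (\<Sum>j\<in>J'. M i' j * c j) - M i' j0 / M i j0 * s"
        by (simp only: s_def sum_subtractf sum_distrib_left)
      finally show ?thesis by (simp add: sum')
    qed
    moreover have "\<exists>j\<in>J. c' j \<noteq> 0"
    proof -
      obtain j where "j \<in> J'" "c j \<noteq> 0" using c(1) by blast
      then have "j \<in> J" "c' j \<noteq> 0" by (auto simp: J'_def c'_def)
      then show ?thesis by blast
    qed
    ultimately show ?thesis by blast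
  qed
qed

section \<open>Algebraic dependence by counting monomials\<close>

text \<open>The two degrees are bounded separately, so that the polynomials allowed are described by
  \<open>(d + 1)\<^sup>2\<close> coefficients and the bounds add up under multiplication.\<close>

definition bidegree_le :: "'a::zero poly poly \<Rightarrow> nat \<Rightarrow> bool" where
  "bidegree_le F d \<longleftrightarrow> degree F \<le> d \<and> (\<forall>j. degree (coeff F j) \<le> d)"

lemma bidegree_le_mono: "bidegree_le F d \<Longrightarrow> d \<le> e \<Longrightarrow> bidegree_le F e"
  unfolding bidegree_le_def by (meson order_trans)

lemma bidegree_le_mult:
  fixes F H :: "'a::comm_semiring_0 poly poly"
  assumes "bidegree_le F d" "bidegree_le H e"
  shows "bidegree_le (F * H) (d + e)"
proof -
  have "degree (coeff (F * H) j) \<le> d + e" for j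
    unfolding coeff_mult
  proof (intro degree_sum_le)
    fix i assume "i \<in> {..j}"
    have "degree (coeff F i * coeff H (j - i)) \<le> degree (coeff F i) + degree (coeff H (j - i))"
      by (rule degree_mult_le)
    also have "\<dots> \<le> d + e" using assms by (intro add_mono) (auto simp: bidegree_le_def)
    finally show "degree (coeff F i * coeff H (j - i)) \<le> d + e" .
  qed simp
  moreover have "degree (F * H) \<le> d + e"
    using degree_mult_le[of F H] assms by (auto simp: bidegree_le_def)
  ultimately show ?thesis by (simp add: bidegree_le_def)
qed

lemma bidegree_le_power:
  fixes F :: "'a::comm_semiring_1 poly poly"
  assumes "bidegree_le F d"
  shows "bidegree_le (F ^ n) (n * d)"
proof (induction n)
  case 0
  show ?case by (auto simp: bidegree_le_def coeff_1)
next
  case (Suc n)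
  then show ?case using bidegree_le_mult[OF assms Suc.IH] by simp
qed

lemma poly2_monomial_sum_eq_0:
  assumes "\<And>x y. (\<Sum>i\<le>N. \<Sum>j\<le>N. c i j * x ^ i * y ^ j) = (0::complex)" "i \<le> N" "j \<le> N"
  shows "c i j = 0"
proof -
  define F where "F = (\<Sum>i\<le>N. \<Sum>j\<le>N. monom (monom (c i j) i) j)"
  have "bieval F q = 0" for q
    using assms(1)[of "fst q" "snd q"] by (cases q) (simp add: F_def bieval_sum)
  then have "F = 0" using bieval_eq_0_iff by blast
  have "coeff (coeff F j) i = (\<Sum>i'\<le>N. \<Sum>j'\<le>N. if j' = j then if i' = i then c i j else 0 else 0)"
    unfolding F_def coeff_sum
    by (intro sum.cong refl) (auto simp: coeff_sum)
  also have "\<dots> = c i j" using assms(2,3) by simp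
  finally show ?thesis using \<open>F = 0\<close> by simp
qed

text \<open>Three polynomials in two variables are dependent by dimension: the number of products
  \<open>E ^ i * (F ^ j * H ^ k)\<close> with exponents up to \<open>n\<close> grows like the cube
  of \<open>n\<close>, the number of their coefficients only like the square. Collecting powers of
  \<open>X\<close> gives the stated form.\<close>

lemma poly2_algebraic_dependence:
  assumes "poly_map2 f" "poly2 X"
  shows "\<exists>n c. (\<forall>i\<le>n. poly2 (c i)) \<and> (\<exists>i\<le>n. \<exists>q. c i q \<noteq> 0) \<and>
           (\<forall>z. (\<Sum>i\<le>n. c i (f z) * X z ^ i) = 0)"
proof -
  obtain E F H where EFH: "X = bieval E" "(\<lambda>z. fst (f z)) = bieval F" "(\<lambda>z. snd (f z)) = bieval H"
    using poly2D assms unfolding poly_map2_def by metis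
  obtain d1 d2 d3 where d: "bidegree_le E d1" "bidegree_le F d2" "bidegree_le H d3"
    using bidegree_bound unfolding bidegree_le_def by metis
  define d where "d = d1 + d2 + d3"
  \<comment> \<open>Chosen so that \<open>(3 * (d + 1) * (n + 1))\<^sup>2\<close> equals
    \<open>n * (n + 1)\<^sup>2\<close>, which is less than \<open>(n + 1) ^ 3\<close>.\<close>
  define n where "n = 9 * (d + 1)\<^sup>2"
  define m where "m = n * d"
  define R where "R = (\<lambda>(i, j, k). E ^ i * (F ^ j * H ^ k))"
  define J where "J = {..n} \<times> {..n} \<times> {..n}"
  define I where "I = {..3 * m} \<times> {..3 * m}"
  have R: "bidegree_le (R t) (3 * m)" if "t \<in> J" for t
  proof -
    obtain i j k where t: "t = (i, j, k)" by (cases t)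
    then have ijk: "i \<le> n" "j \<le> n" "k \<le> n" using that by (auto simp: J_def)
    have le: "l * e \<le> m" if "l \<le> n" "e \<le> d" for l e unfolding m_def using that by (rule mult_mono) auto
    have "bidegree_le (E ^ i) m" "bidegree_le (F ^ j) m" "bidegree_le (H ^ k) m"
      using ijk by (auto intro!: le bidegree_le_mono[OF bidegree_le_power[OF d(1)]]
          bidegree_le_mono[OF bidegree_le_power[OF d(2)]]
          bidegree_le_mono[OF bidegree_le_power[OF d(3)]] simp: d_def)
    then have "bidegree_le (R t) (m + (m + m))" unfolding R_def t by (simp add: bidegree_le_mult)
    moreover have "m + (m + m) = 3 * m" by simp
    ultimately show ?thesis by (simp only:)
  qed
  have "3 * m + 1 \<le> 3 * (d + 1) * (n + 1)" by (simp add: m_def algebra_simps)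
  then have "(3 * m + 1)\<^sup>2 \<le> (3 * (d + 1) * (n + 1))\<^sup>2" by (rule power_mono) simp
  also have "\<dots> = n * (n + 1)\<^sup>2" unfolding n_def by algebra
  also have "\<dots> < (n + 1) * (n + 1)\<^sup>2" by simp
  finally have "card I < card J" by (simp add: I_def J_def power2_eq_square)
  \<comment> \<open>One unknown for each triple of exponents, one equation for each coefficient that
    has to vanish.\<close>
  then obtain c where c: "\<exists>t\<in>J. c t \<noteq> 0"
    "\<forall>s\<in>I. (\<Sum>t\<in>J. coeff (coeff (R t) (snd s)) (fst s) * c t) = 0"
    using homogeneous_system_nontrivial_solution[of I J "\<lambda>s t. coeff (coeff (R t) (snd s)) (fst s)"]
    by (auto simp: I_def J_def)
  have zero: "(\<Sum>t\<in>J. c t * bieval (R t) z) = 0" for z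
  proof -
    obtain x y where z: "z = (x, y)" by force
    have "(\<Sum>t\<in>J. c t * bieval (R t) z) =
        (\<Sum>t\<in>J. c t * (\<Sum>i\<le>3 * m. \<Sum>j\<le>3 * m. coeff (coeff (R t) j) i * x ^ i * y ^ j))"
      using R unfolding z bidegree_le_def by (intro sum.cong) (auto simp: bieval_eq_double_sum)
    also have "\<dots> = (\<Sum>t\<in>J. \<Sum>(i, j)\<in>I. coeff (coeff (R t) j) i * c t * (x ^ i * y ^ j))"
      by (simp add: I_def sum.cartesian_product sum_distrib_left case_prod_unfold mult_ac)
    also have "\<dots> = (\<Sum>(i, j)\<in>I. \<Sum>t\<in>J. coeff (coeff (R t) j) i * c t * (x ^ i * y ^ j))"
      by (subst sum.swap) (simp add: case_prod_unfold)
    also have "\<dots> = (\<Sum>(i, j)\<in>I. (\<Sum>t\<in>J. coeff (coeff (R t) j) i * c t) * (x ^ i * y ^ j))"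
      by (simp add: sum_distrib_right)
    also have "\<dots> = 0" using c(2) by (intro sum.neutral) auto
    finally show ?thesis .
  qed
  define C where "C = (\<lambda>i q. \<Sum>j\<le>n. \<Sum>k\<le>n. c (i, j, k) * fst q ^ j * snd q ^ k)"
  have "poly2 (C i)" for i
    unfolding C_def by (intro poly2_intros)
  moreover have "(\<Sum>i\<le>n. C i (f z) * X z ^ i) = 0" for z
  proof -
    have "fst (f z) = bieval F z" "snd (f z) = bieval H z" using EFH by (auto dest: fun_cong)
    then have "(\<Sum>i\<le>n. C i (f z) * X z ^ i) =
       (\<Sum>i\<le>n. \<Sum>j\<le>n. \<Sum>k\<le>n. c (i, j, k) * (bieval E z ^ i * (bieval F z ^ j * bieval H z ^ k)))"
      by (simp add: C_def EFH(1) sum_distrib_right sum_distrib_left mult_ac)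
    also have "\<dots> = (\<Sum>t\<in>J. c t * bieval (R t) z)"
      by (simp add: J_def R_def sum.cartesian_product case_prod_unfold)
    finally show ?thesis using zero by simp
  qed
  \<comment> \<open>If all \<open>C i\<close> vanished as functions, all their coefficients would,
    so \<open>c\<close> would be the trivial solution.\<close>
  moreover have "\<exists>i\<le>n. \<exists>q. C i q \<noteq> 0"
  proof (rule ccontr)
    assume neg: "\<not> ?thesis"
    have "c (i, j, k) = 0" if "i \<le> n" "j \<le> n" "k \<le> n" for i j k
    proof (rule poly2_monomial_sum_eq_0[where N = n and c = "\<lambda>j k. c (i, j, k)"])
      show "(\<Sum>j\<le>n. \<Sum>k\<le>n. c (i, j, k) * x ^ j * y ^ k) = 0" for x y
        using neg \<open>i \<le> n\<close> by (auto simp: C_def dest!: spec[of _ "(x, y)"])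
    qed (use that in auto)
    then show False using c(1) by (auto simp: J_def)
  qed
  ultimately show ?thesis by blast
qed

section \<open>Relations of least degree and their consequences\<close>

text \<open>Choose a nontrivial relation with \<open>n\<close> least. Its leading coefficient is
  nonzero, since otherwise it could be shortened; \<open>n = 0\<close> would give a nonzero
  polynomial vanishing on the range. The last conclusion is minimality in the form used later: a
  relation with exponents below \<open>n\<close> is trivial.\<close>

lemma minimal_algebraic_relation:
  assumes "poly_map2 f" "dominant f" "poly2 X"
  obtains n c where "\<And>i. i \<le> n \<Longrightarrow> poly2 (c i)" "\<exists>q. c n q \<noteq> 0" "n > 0"
    "\<And>z. (\<Sum>i\<le>n. c i (f z) * X z ^ i) = 0"
    "\<And>d. (\<And>i. i < n \<Longrightarrow> poly2 (d i)) \<Longrightarrow> (\<And>z. (\<Sum>i<n. d i (f z) * X z ^ i) = 0) \<Longrightarrow>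
        (\<And>i q. i < n \<Longrightarrow> d i q = 0)"
proof -
  define Rel where "Rel = (\<lambda>n c. (\<forall>i\<le>n. poly2 (c i)) \<and> (\<exists>i\<le>n. \<exists>q. c i q \<noteq> 0) \<and>
           (\<forall>z. (\<Sum>i\<le>n. c i (f z) * X z ^ i) = 0))"
  define n where "n = (LEAST n. \<exists>c. Rel n c)"
  have "\<exists>n. \<exists>c. Rel n c" using poly2_algebraic_dependence[OF assms(1,3)] by (simp add: Rel_def)
  then have "\<exists>c. Rel n c" unfolding n_def by (rule LeastI_ex)
  then obtain c where c: "Rel n c" by blast
  have least: "\<not> Rel m d" if "m < n" for m d
    using not_less_Least[of m "\<lambda>n. \<exists>c. Rel n c"] that unfolding n_def by blast
  have min: "d i q = 0" if "\<And>i. i < n \<Longrightarrow> poly2 (d i)"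
    "\<And>z. (\<Sum>i<n. d i (f z) * X z ^ i) = 0" "i < n" for d i q
  proof (rule ccontr)
    assume "d i q \<noteq> 0"
    obtain m where m: "n = Suc m" using \<open>i < n\<close> by (cases n) auto
    have "\<exists>i\<le>m. \<exists>q. d i q \<noteq> 0" using \<open>d i q \<noteq> 0\<close> \<open>i < n\<close> m less_Suc_eq_le by blast
    then have "Rel m d" unfolding Rel_def using that(1,2)
      by (simp only: m lessThan_Suc_atMost less_Suc_eq_le) blast
    then show False using least m by blast
  qed
  have "n > 0"
  proof (rule ccontr)
    assume "\<not> ?thesis"
    then have "n = 0" by simp
    then obtain q where "poly2 (c 0)" "c 0 q \<noteq> 0" "\<And>z. c 0 (f z) = 0" using c by (auto simp: Rel_def)
    then show False using poly2_vanishing_on_range[OF _ assms(2)] by blast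
  qed
  have "\<exists>q. c n q \<noteq> 0"
  proof (rule ccontr)
    assume neg: "\<not> ?thesis"
    have "(\<Sum>i<n. c i (f z) * X z ^ i) = 0" for z
    proof -
      have "(\<Sum>i\<le>n. c i (f z) * X z ^ i) = 0" using c by (simp add: Rel_def)
      then show ?thesis using neg by (simp add: lessThan_Suc_atMost[symmetric])
    qed
    then have "c i q = 0" if "i < n" for i q using min[of c i q] that c by (simp add: Rel_def)
    then have "c i q = 0" if "i \<le> n" for i q using that neg le_neq_implies_less by blast
    then show False using c by (auto simp: Rel_def)
  qed
  then show thesis using that[of n c] c \<open>n > 0\<close> min by (simp add: Rel_def)
qed

text \<open>The constant term \<open>c 0\<close> of a minimal relation serves as \<open>e\<close>:
  where \<open>X\<close> vanishes, the relation reduces to \<open>c 0 (f z) = 0\<close>. It is not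
  the zero polynomial, because otherwise a factor \<open>X\<close> could be cancelled from the
  relation, against minimality. Thus a nonzero condition on the source follows from a nonzero
  condition on the target.\<close>

lemma nonvanishing_from_image:
  assumes "poly_map2 f" "dominant f" "poly2 X" "\<exists>z. X z \<noteq> 0"
  obtains e where "poly2 e" "\<exists>q. e q \<noteq> 0" "\<And>z. e (f z) \<noteq> 0 \<Longrightarrow> X z \<noteq> 0"
proof -
  obtain n c where c: "\<And>i. i \<le> n \<Longrightarrow> poly2 (c i)" "\<exists>q. c n q \<noteq> 0" "n > 0"
    "\<And>z. (\<Sum>i\<le>n. c i (f z) * X z ^ i) = 0"
    and min: "\<And>d i q. (\<And>i. i < n \<Longrightarrow> poly2 (d i)) \<Longrightarrow>
      (\<And>z. (\<Sum>i<n. d i (f z) * X z ^ i) = 0) \<Longrightarrow> i < n \<Longrightarrow> d i q = 0"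
    by (rule minimal_algebraic_relation[OF assms(1-3)]) blast
  have split: "(\<Sum>i\<le>n. c i (f z) * X z ^ i) = c 0 (f z) + X z * (\<Sum>i<n. c (Suc i) (f z) * X z ^ i)" for z
    by (subst sum.atMost_shift) (simp add: sum_distrib_left mult_ac)
  have "\<exists>q. c 0 q \<noteq> 0"
  proof (rule ccontr)
    assume "\<not> ?thesis"
    then have neg: "c 0 q = 0" for q by blast
    define Y where "Y = (\<lambda>z. \<Sum>i<n. c (Suc i) (f z) * X z ^ i)"
    have XY: "X z * Y z = 0" for z using c(4)[of z] split[of z] neg by (simp add: Y_def)
    have pc: "poly2 (\<lambda>z. c i (f z))" if "i \<le> n" for i
      using poly2_compose_map[OF c(1)[OF that] assms(1)] .
    have "poly2 Y" unfolding Y_def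
      by (intro poly2_sum poly2_mult poly2_power pc assms(3)) auto
    then have "Y z = 0" for z
      using poly2_mult_nonzero[OF assms(3) _ assms(4), of Y] XY by blast
    then have "c (Suc (n - 1)) q = 0" for q
      using c(1,3) min[of "\<lambda>i. c (Suc i)" "n - 1" q] by (simp add: Y_def)
    then show False using c(2,3) by simp
  qed
  moreover have "X z \<noteq> 0" if "c 0 (f z) \<noteq> 0" for z
    using c(4)[of z] split[of z] that by auto
  ultimately show thesis using that[of "c 0"] c(1) by blast
qed

text \<open>The derivative of a minimal relation with respect to \<open>X\<close> has only exponents
  below \<open>n\<close>, so it cannot vanish identically. The preceding lemma converts its
  nonvanishing at \<open>z\<close> into a condition on \<open>f z\<close>, over which
  \<open>X z\<close> is then a simple root.\<close>

lemma separable_algebraic_relation: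
  assumes "poly_map2 f" "dominant f" "poly2 X"
  obtains n c e where "\<And>i. i \<le> n \<Longrightarrow> poly2 (c i)" "\<exists>q. c n q \<noteq> 0" "n > 0"
    "\<And>z. (\<Sum>i\<le>n. c i (f z) * X z ^ i) = 0"
    "poly2 e" "\<exists>q. e q \<noteq> 0"
    "\<And>z. e (f z) \<noteq> 0 \<Longrightarrow> (\<Sum>i\<le>n. c i (f z) * (of_nat i * X z ^ (i - 1))) \<noteq> 0"
proof -
  obtain n c where c: "\<And>i. i \<le> n \<Longrightarrow> poly2 (c i)" "\<exists>q. c n q \<noteq> 0" "n > 0"
    "\<And>z. (\<Sum>i\<le>n. c i (f z) * X z ^ i) = 0"
    and min: "\<And>d i q. (\<And>i. i < n \<Longrightarrow> poly2 (d i)) \<Longrightarrow>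
      (\<And>z. (\<Sum>i<n. d i (f z) * X z ^ i) = 0) \<Longrightarrow> i < n \<Longrightarrow> d i q = 0"
    by (rule minimal_algebraic_relation[OF assms(1-3)]) blast
  define D where "D = (\<lambda>z. \<Sum>i\<le>n. c i (f z) * (of_nat i * X z ^ (i - 1)))"
  have D: "D z = (\<Sum>i<n. (of_nat (Suc i) * c (Suc i) (f z)) * X z ^ i)" for z
    unfolding D_def by (subst sum.atMost_shift) (simp add: mult_ac)
  have pc: "poly2 (\<lambda>z. c i (f z))" if "i \<le> n" for i
    using poly2_compose_map[OF c(1)[OF that] assms(1)] .
  have "poly2 D" unfolding D_def
    by (intro poly2_sum poly2_mult poly2_power poly2_const pc assms(3)) auto
  moreover have "\<exists>z. D z \<noteq> 0"
  proof (rule ccontr)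
    assume "\<not> ?thesis"
    \<comment> \<open>Minimality would kill every coefficient of the derivative, in particular
      \<open>n\<close> times the leading one; characteristic zero makes this a
      contradiction.\<close>
    then have "of_nat (Suc (n - 1)) * c (Suc (n - 1)) q = 0" for q
      using c(1,3) min[of "\<lambda>i q. of_nat (Suc i) * c (Suc i) q" "n - 1" q]
      by (simp add: D[symmetric] poly2_mult del: of_nat_Suc)
    then show False using c(2,3) by simp
  qed
  ultimately obtain e where "poly2 e" "\<exists>q. e q \<noteq> 0" "\<And>z. e (f z) \<noteq> 0 \<Longrightarrow> D z \<noteq> 0"
    using nonvanishing_from_image[OF assms(1,2)] by blast
  then show thesis using that[of n c e] c unfolding D_def by blast
qed

subsection \<open>Rationality of the inverse of a generically injective map\<close>

text \<open>Multiplied by \<open>c n ^ (n - 1)\<close>, the equation becomes monic in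
  \<open>c n * T\<close> with coefficients \<open>c i * c n ^ (n - 1 - i)\<close>; this is Cauchy's
  root bound for it. No division by \<open>c n\<close> occurs, so the bound stays finite where the
  leading coefficient vanishes.\<close>

lemma leading_coeff_times_root_bound:
  fixes c :: "nat \<Rightarrow> complex"
  assumes "(\<Sum>i\<le>n. c i * T ^ i) = 0" "n > 0"
  shows "norm (c n * T) \<le> 1 + (\<Sum>i<n. norm (c i * c n ^ (n - 1 - i)))"
proof (cases "norm (c n * T) \<le> 1")
  case True
  then show ?thesis by (simp add: add_increasing2 sum_nonneg)
next
  case False
  define S where "S = c n * T"
  obtain m where m: "n = Suc m" using assms(2) by (cases n) auto
  have S: "norm S > 1" using False by (simp add: S_def)
  have "0 = (\<Sum>i\<le>n. c i * T ^ i) * c n ^ m" using assms(1) by simp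
  also have "\<dots> = (\<Sum>i\<le>n. c i * T ^ i * c n ^ m)" by (rule sum_distrib_right)
  also have "\<dots> = (\<Sum>i<n. c i * T ^ i * c n ^ m) + c n * T ^ n * c n ^ m"
    by (simp add: lessThan_Suc_atMost[symmetric])
  also have "c n * T ^ n * c n ^ m = S ^ n" by (simp add: m S_def power_mult_distrib mult_ac)
  also have "(\<Sum>i<n. c i * T ^ i * c n ^ m) = (\<Sum>i<n. c i * c n ^ (n - 1 - i) * S ^ i)"
  proof (intro sum.cong refl)
    fix i assume "i \<in> {..<n}"
    then have "c n ^ m = c n ^ (n - 1 - i) * c n ^ i" by (simp add: m power_add[symmetric])
    then show "c i * T ^ i * c n ^ m = c i * c n ^ (n - 1 - i) * S ^ i"
      by (simp add: S_def power_mult_distrib)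
  qed
  finally have "S ^ n = - (\<Sum>i<n. c i * c n ^ (n - 1 - i) * S ^ i)"
    by (simp add: eq_neg_iff_add_eq_0 add.commute)
  then have "norm S ^ n = norm (\<Sum>i<n. c i * c n ^ (n - 1 - i) * S ^ i)"
    by (metis norm_minus_cancel norm_power)
  also have "\<dots> \<le> (\<Sum>i<n. norm (c i * c n ^ (n - 1 - i)) * norm S ^ m)"
  proof (intro sum_norm_le)
    fix i assume "i \<in> {..<n}"
    then have "norm S ^ i \<le> norm S ^ m" using S m by (intro power_increasing) auto
    then show "norm (c i * c n ^ (n - 1 - i) * S ^ i) \<le> norm (c i * c n ^ (n - 1 - i)) * norm S ^ m"
      unfolding norm_mult[of _ "S ^ i"] norm_power[of S i] by (rule mult_left_mono) simp
  qed
  also have "\<dots> = (\<Sum>i<n. norm (c i * c n ^ (n - 1 - i))) * norm S ^ m"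
    by (simp only: sum_distrib_right)
  finally have "norm S * norm S ^ m \<le> (\<Sum>i<n. norm (c i * c n ^ (n - 1 - i))) * norm S ^ m"
    by (simp add: m)
  then have "norm S \<le> (\<Sum>i<n. norm (c i * c n ^ (n - 1 - i)))"
    by (rule mult_right_le_imp_le) (use S in \<open>intro zero_less_power, linarith\<close>)
  then show ?thesis by (simp add: S_def)
qed

text \<open>Writing the relation at \<open>s\<close> minus the relation at \<open>s0\<close> as
  \<open>(t s - t s0) * E s + N s\<close> exhibits the difference quotient of \<open>t\<close> as that of \<open>- N\<close> over \<open>E\<close>.\<close>

lemma continuous_simple_root_differentiable:
  fixes p :: "nat \<Rightarrow> complex poly" and t :: "complex \<Rightarrow> complex"
  assumes "isCont t s0" "open U" "s0 \<in> U"
    and root: "\<And>s. s \<in> U \<Longrightarrow> (\<Sum>i\<le>n. poly (p i) s * t s ^ i) = 0"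
    and simple: "(\<Sum>i\<le>n. poly (p i) s0 * (of_nat i * t s0 ^ (i - 1))) \<noteq> 0"
  shows "t field_differentiable at s0"
proof -
  define N where "N = (\<lambda>s. \<Sum>i\<le>n. poly (p i) s * t s0 ^ i)"
  define E where "E = (\<lambda>s. \<Sum>i\<le>n. poly (p i) s * (\<Sum>j<i. t s0 ^ (i - Suc j) * t s ^ j))"
  have "N = poly (\<Sum>i\<le>n. smult (t s0 ^ i) (p i))"
    by (simp add: N_def fun_eq_iff poly_sum mult.commute)
  then have "N field_differentiable at s0"
    unfolding field_differentiable_def using poly_DERIV by blast
  then obtain N' where N': "((\<lambda>s. (N s - N s0) / (s - s0)) \<longlongrightarrow> N') (at s0)"
    unfolding field_differentiable_def has_field_derivative_iff by blast
  have "isCont E s0" unfolding E_def using assms(1) by (intro continuous_intros) auto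
  then have E: "(E \<longlongrightarrow> E s0) (at s0)" by (simp add: isCont_def)
  have "E s0 = (\<Sum>i\<le>n. poly (p i) s0 * (of_nat i * t s0 ^ (i - 1)))"
    unfolding E_def by (intro sum.cong refl) (auto simp: power_add[symmetric])
  then have E0: "E s0 \<noteq> 0" using simple by simp
  have eq: "(t s - t s0) * E s = - (N s - N s0)" if "s \<in> U" for s
  proof -
    have "(t s - t s0) * E s = (\<Sum>i\<le>n. poly (p i) s * ((t s - t s0) * (\<Sum>j<i. t s0 ^ (i - Suc j) * t s ^ j)))"
      by (simp add: E_def sum_distrib_left mult_ac)
    also have "\<dots> = (\<Sum>i\<le>n. poly (p i) s * (t s ^ i - t s0 ^ i))"
      by (simp add: power_diff_sumr2)
    also have "\<dots> = (\<Sum>i\<le>n. poly (p i) s * t s ^ i) - N s"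
      by (simp add: N_def right_diff_distrib sum_subtractf)
    finally show ?thesis using root[OF that] root[OF assms(3)] by (simp add: N_def)
  qed
  have "((\<lambda>s. - ((N s - N s0) / (s - s0)) / E s) \<longlongrightarrow> - N' / E s0) (at s0)"
    using N' E E0 by (intro tendsto_intros)
  moreover have "\<forall>\<^sub>F s in at s0. - ((N s - N s0) / (s - s0)) / E s = (t s - t s0) / (s - s0)"
  proof -
    have "\<forall>\<^sub>F s in at s0. E s \<noteq> 0" using E E0 by (rule tendsto_imp_eventually_ne)
    moreover have "\<forall>\<^sub>F s in at s0. s \<in> U" using assms(2,3) by (rule eventually_at_in_open')
    ultimately show ?thesis
    proof eventually_elim
      case (elim s)
      have "t s - t s0 = - (N s - N s0) / E s"
        using eq[OF elim(2)] elim(1) by (simp add: eq_divide_eq)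
      then show ?case by (simp add: minus_divide_left mult.commute)
    qed
  qed
  ultimately have "((\<lambda>s. (t s - t s0) / (s - s0)) \<longlongrightarrow> - N' / E s0) (at s0)"
    by (rule Lim_transform_eventually)
  then show ?thesis unfolding field_differentiable_def has_field_derivative_iff by blast
qed

text \<open>The difference quotient is at most \<open>norm (s - s0) * K s\<close>, so the derivative
  is 0. This covers the points where a function has been extended by 0 after multiplication with the
  square of a vanishing factor.\<close>

lemma differentiable_of_quadratic_bound:
  fixes w :: "complex \<Rightarrow> complex"
  assumes "w s0 = 0" "isCont K s0" "\<And>s. norm (w s) \<le> norm (s - s0) ^ 2 * K s"
  shows "w field_differentiable at s0"
proof -
  have "((\<lambda>s. (w s - w s0) / (s - s0)) \<longlongrightarrow> 0) (at s0)"
  proof (rule Lim_null_comparison)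
    show "\<forall>\<^sub>F s in at s0. norm ((w s - w s0) / (s - s0)) \<le> norm (s - s0) * K s"
    proof (rule eventually_mono[OF eventually_neq_at_within[of s0]])
      fix s assume "s \<noteq> s0"
      then show "norm ((w s - w s0) / (s - s0)) \<le> norm (s - s0) * K s"
        using assms(3)[of s] assms(1) by (simp add: norm_divide power2_eq_square field_simps)
    qed
    have "isCont (\<lambda>s. norm (s - s0) * K s) s0" using assms(2) by (intro continuous_intros)
    then show "((\<lambda>s. norm (s - s0) * K s) \<longlongrightarrow> 0) (at s0)" by (simp add: isCont_def)
  qed
  then show ?thesis unfolding field_differentiable_def has_field_derivative_iff by blast
qed

section \<open>Recognising polynomials by growth and interpolation\<close>

text \<open>The polynomial form of Liouville's theorem. The degree bound is recorded because
  interpolation needs it uniformly over all parallel lines.\<close>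

lemma entire_of_poly_growth_eq_poly:
  assumes "w holomorphic_on UNIV" "\<And>s. norm (w s) \<le> C * (1 + norm s) ^ N"
  shows "\<exists>p. degree p \<le> N \<and> (\<forall>s. w s = poly p s)"
proof -
  have C: "C \<ge> 0"
  proof -
    have "0 \<le> norm (w 0)" by simp
    also have "\<dots> \<le> C" using assms(2)[of 0] by simp
    finally show ?thesis .
  qed
  have bound: "norm (w s) \<le> (C * 2 ^ N) * norm s ^ N" if "1 \<le> norm s" for s
  proof -
    have "(1 + norm s) ^ N \<le> (2 * norm s) ^ N" using that by (intro power_mono) auto
    then have "C * (1 + norm s) ^ N \<le> C * (2 * norm s) ^ N" using C by (rule mult_left_mono)
    then show ?thesis using assms(2)[of s] by (simp add: power_mult_distrib mult.assoc)
  qed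
  define d where "d = (\<lambda>k. (deriv ^^ k) w 0 / fact k)"
  have "w s = (\<Sum>k\<le>N. d k * s ^ k)" for s
    unfolding d_def using Liouville_polynomial[OF assms(1) bound] by blast
  then have "\<forall>s. w s = poly (\<Sum>k\<le>N. monom (d k) k) s" by (simp add: poly_sum poly_monom)
  moreover have "degree (\<Sum>k\<le>N. monom (d k) k) \<le> N"
    by (intro degree_sum_le) (auto intro: order_trans[OF degree_monom_le])
  ultimately show ?thesis by blast
qed

lemma poly2_poly [poly2_intros]: "poly2 P \<Longrightarrow> poly2 (\<lambda>q. poly p (P q))"
  unfolding poly_altdef by (intro poly2_sum poly2_mult poly2_power poly2_const)

text \<open>The uniform degree bound in the first variable permits Lagrange interpolation at the
  fixed nodes 0, ..., \<open>N\<close>: \<open>W (a, b)\<close> is the sum of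
  \<open>poly (l i) a * W (of_nat i, b)\<close>, and each \<open>W (of_nat i, b)\<close> is a
  polynomial in \<open>b\<close>.\<close>

lemma separately_polynomial_imp_poly2:
  fixes W :: "complex \<times> complex \<Rightarrow> complex"
  assumes "\<And>b. \<exists>p. degree p \<le> N \<and> (\<forall>a. W (a, b) = poly p a)" "\<And>a. \<exists>p. \<forall>b. W (a, b) = poly p b"
  shows "poly2 W"
proof -
  \<comment> \<open>The Lagrange basis polynomials for the nodes 0, ..., \<open>N\<close>.\<close>
  define l where "l = (\<lambda>i. \<Prod>j\<in>{..N} - {i}. smult (inverse (of_nat i - of_nat j)) [:- of_nat j, 1 :: complex:])"
  have deg: "degree (l i) \<le> N" if "i \<le> N" for i
  proof -
    have "degree (l i) \<le> (\<Sum>j\<in>{..N} - {i}. degree (smult (inverse (of_nat i - of_nat j)) [:- of_nat j, 1 :: complex:]))"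
      unfolding l_def by (rule degree_prod_sum_le[unfolded o_def]) simp
    also have "\<dots> \<le> (\<Sum>j\<in>{..N} - {i}. 1)" by (intro sum_mono) (simp add: degree_smult_le)
    finally show ?thesis using that by simp
  qed
  have l: "poly (l i) (of_nat k) = (if k = i then 1 else 0)" if "i \<le> N" "k \<le> N" for i k
  proof (cases "k = i")
    case True
    have "poly (smult (inverse (of_nat i - of_nat j)) [:- of_nat j, 1 :: complex:]) (of_nat i) = 1"
      if "j \<in> {..N} - {i}" for j
    proof -
      have "of_nat i - of_nat j \<noteq> (0::complex)" using that by auto
      then show ?thesis unfolding poly_smult by simp
    qed
    then show ?thesis unfolding l_def poly_prod using True by (simp only: prod.neutral_const cong: prod.cong) simp
  next
    case False
    then show ?thesis using that by (auto simp: l_def poly_prod intro!: bexI[of _ k])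
  qed
  have W: "W (a, b) = (\<Sum>i\<le>N. poly (l i) a * W (of_nat i, b))" for a b
  proof -
    obtain p where p: "degree p \<le> N" "\<And>a. W (a, b) = poly p a" using assms(1)[of b] by blast
    define r where "r = (\<Sum>i\<le>N. smult (W (of_nat i, b)) (l i))"
    have "p = r"
    proof (rule poly_eqI_degree)
      fix x :: complex assume "x \<in> of_nat ` {..N}"
      then obtain k where k: "x = of_nat k" "k \<le> N" by auto
      have "poly r x = (\<Sum>i\<le>N. if k = i then W (of_nat i, b) else 0)"
        unfolding r_def poly_sum by (intro sum.cong) (auto simp: k l)
      then show "poly p x = poly r x" using k by (simp add: p(2))
    next
      have card: "card (of_nat ` {..N} :: complex set) = Suc N"
        by (subst card_image) (auto simp: inj_on_def)
      have "degree r \<le> N" unfolding r_def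
        by (intro degree_sum_le) (auto intro: order_trans[OF degree_smult_le] deg)
      then show "degree r < card (of_nat ` {..N} :: complex set)" by (simp add: card)
      show "degree p < card (of_nat ` {..N} :: complex set)" using p by (simp add: card)
    qed
    then have "W (a, b) = poly r a" by (simp add: p(2))
    then show ?thesis by (simp add: r_def poly_sum mult.commute)
  qed
  obtain r where r: "\<And>a b. W (a, b) = poly (r a) b" using assms(2) by metis
  have W_eq: "W = (\<lambda>q. \<Sum>i\<le>N. poly (l i) (fst q) * poly (r (of_nat i)) (snd q))"
  proof
    fix q show "W q = (\<Sum>i\<le>N. poly (l i) (fst q) * poly (r (of_nat i)) (snd q))"
      using W[of "fst q" "snd q"] r by simp
  qed
  show ?thesis unfolding W_eq
    by (intro poly2_sum poly2_mult poly2_poly poly2_fst poly2_snd)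
qed

lemma poly2_growth:
  assumes "poly2 P"
  shows "\<exists>C N. C \<ge> 0 \<and> (\<forall>a b. norm (P (a, b)) \<le> C * (1 + norm a) ^ N * (1 + norm b) ^ N)"
proof -
  obtain N :: nat and d where d: "\<And>x y. P (x, y) = (\<Sum>i\<le>N. \<Sum>j\<le>N. d i j * x ^ i * y ^ j)"
    using assms(1) unfolding poly2_def by blast
  define C where "C = (\<Sum>i\<le>N. \<Sum>j\<le>N. norm (d i j))"
  have pow: "norm (x::complex) ^ i \<le> (1 + norm x) ^ N" if "i \<le> N" for x i
  proof -
    have "norm x ^ i \<le> (1 + norm x) ^ i" by (intro power_mono) auto
    also have "\<dots> \<le> (1 + norm x) ^ N" using that by (intro power_increasing) auto
    finally show ?thesis .
  qed
  have "norm (P (a, b)) \<le> C * (1 + norm a) ^ N * (1 + norm b) ^ N" for a b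
  proof -
    have "norm (P (a, b)) \<le> (\<Sum>i\<le>N. \<Sum>j\<le>N. norm (d i j) * ((1 + norm a) ^ N * (1 + norm b) ^ N))"
      unfolding d
    proof (intro sum_norm_le)
      fix i j assume "i \<in> {..N}" "j \<in> {..N}"
      then show "norm (d i j * a ^ i * b ^ j) \<le> norm (d i j) * ((1 + norm a) ^ N * (1 + norm b) ^ N)"
        unfolding norm_mult norm_power mult.assoc
        by (intro mult_left_mono mult_mono pow) auto
    qed
    also have "\<dots> = C * (1 + norm a) ^ N * (1 + norm b) ^ N"
      by (simp add: C_def sum_distrib_right mult.assoc)
    finally show ?thesis .
  qed
  moreover have "C \<ge> 0" by (simp add: C_def sum_nonneg)
  ultimately show ?thesis by blast
qed

text \<open>Adding the constants and the exponents of the summands gives a common bound; it will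
  control the right-hand side of the root bound.\<close>

lemma sum_poly2_growth:
  assumes "finite I" "\<And>i. i \<in> I \<Longrightarrow> poly2 (P i)"
  shows "\<exists>C N. C \<ge> 0 \<and> (\<forall>a b. (\<Sum>i\<in>I. norm (P i (a, b))) \<le> C * (1 + norm a) ^ N * (1 + norm b) ^ N)"
  using assms
proof (induction I rule: finite_induct)
  case empty
  show ?case by (intro exI[of _ 0]) auto
next
  case (insert i I)
  obtain C N where C: "C \<ge> 0"
    "\<And>a b. (\<Sum>i\<in>I. norm (P i (a, b))) \<le> C * (1 + norm a) ^ N * (1 + norm b) ^ N"
    using insert by blast
  obtain D M where D: "D \<ge> 0"
    "\<And>a b. norm (P i (a, b)) \<le> D * (1 + norm a) ^ M * (1 + norm b) ^ M"
    using poly2_growth[of "P i"] insert.prems by blast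
  have mono: "K * (1 + norm a) ^ n * (1 + norm b) ^ n \<le> K * (1 + norm a) ^ (M + N) * (1 + norm b) ^ (M + N)"
    if "n \<le> M + N" "K \<ge> 0" for K n and a b :: complex
    using that by (intro mult_mono power_increasing mult_nonneg_nonneg) auto
  have "(\<Sum>i\<in>insert i I. norm (P i (a, b))) \<le> (D + C) * (1 + norm a) ^ (M + N) * (1 + norm b) ^ (M + N)" for a b
  proof -
    have "(\<Sum>i\<in>insert i I. norm (P i (a, b))) = norm (P i (a, b)) + (\<Sum>i\<in>I. norm (P i (a, b)))"
      using insert by simp
    also have "\<dots> \<le> D * (1 + norm a) ^ (M + N) * (1 + norm b) ^ (M + N)
        + C * (1 + norm a) ^ (M + N) * (1 + norm b) ^ (M + N)"
      using order_trans[OF D(2) mono[of M D a b]] order_trans[OF C(2) mono[of N C a b]] C(1) D(1)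
      by (intro add_mono) auto
    finally show ?thesis by (simp add: algebra_simps)
  qed
  then show ?case using C(1) D(1) by (intro exI[of _ "D + C"]) auto
qed

lemma poly2_on_line:
  assumes "poly2 P"
  shows "\<exists>p. \<forall>s. P (s, b) = poly p s" "\<exists>p. \<forall>s. P (a, s) = poly p s"
proof -
  obtain F where F: "P = bieval F" using poly2D[OF assms] by blast
  show "\<exists>p. \<forall>s. P (s, b) = poly p s" by (intro exI[of _ "poly F [:b:]"]) (simp add: F bieval_def)
  obtain N :: nat and d where d: "\<And>x y. P (x, y) = (\<Sum>i\<le>N. \<Sum>j\<le>N. d i j * x ^ i * y ^ j)"
    using assms(1) unfolding poly2_def by blast
  show "\<exists>p. \<forall>s. P (a, s) = poly p s"
    by (intro exI[of _ "\<Sum>i\<le>N. \<Sum>j\<le>N. monom (d i j * a ^ i) j"]) (simp add: d poly_sum poly_monom)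
qed

text \<open>Over a closed ball inside \<open>U\<close> the preimage under \<open>f\<close> is
  closed, and boundedness of \<open>h\<close> makes it compact. A continuous injection on a compact
  set has a continuous inverse.\<close>

lemma inverse_continuous_on_locally_bounded:
  fixes f :: "'a::heine_borel \<Rightarrow> 'b::heine_borel" and h :: "'b \<Rightarrow> 'a"
  assumes "continuous_on UNIV f" "open U"
    and inv: "\<And>q. q \<in> U \<Longrightarrow> f (h q) = q" "\<And>z. f z \<in> U \<Longrightarrow> h (f z) = z"
    and bounded: "\<And>K. compact K \<Longrightarrow> K \<subseteq> U \<Longrightarrow> bounded (h ` K)"
  shows "continuous_on U h"
proof -
  have "continuous (at q) h" if q: "q \<in> U" for q
  proof -
    obtain r where r: "r > 0" "cball q r \<subseteq> U" using open_contains_cball assms(2) q by blast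
    have "bounded (h ` cball q r)" using r by (intro bounded) auto
    then have "compact (closure (h ` cball q r))" by (simp add: compact_closure)
    moreover have "closed (f -` cball q r)"
      using continuous_closed_vimage[of "cball q r" f] assms(1)
      by (simp add: continuous_on_eq_continuous_at)
    ultimately have cpt: "compact (closure (h ` cball q r) \<inter> f -` cball q r)" (is "compact ?S")
      by (rule compact_Int_closed)
    have "f ` ?S = cball q r"
    proof
      show "cball q r \<subseteq> f ` ?S"
      proof
        fix y assume y: "y \<in> cball q r"
        have fh: "f (h y) = y" by (rule inv(1)[OF subsetD[OF r(2) y]])
        have "h y \<in> closure (h ` cball q r)" using closure_subset imageI[OF y] by (rule subsetD)
        moreover have "h y \<in> f -` cball q r" unfolding vimage_def mem_Collect_eq fh by (rule y)
        ultimately have "f (h y) \<in> f ` ?S" by blast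
        then show "y \<in> f ` ?S" unfolding fh .
      qed
    qed auto
    moreover have "continuous_on (f ` ?S) h"
      using r inv(2) by (intro continuous_on_inv[OF _ cpt] continuous_on_subset[OF assms(1)]) auto
    ultimately have "continuous_on (ball q r) h" by (metis ball_subset_cball continuous_on_subset)
    then show ?thesis using r by (simp add: continuous_on_eq_continuous_at)
  qed
  then show ?thesis by (simp add: continuous_at_imp_continuous_on)
qed

lemma isCont_on_line:
  fixes h :: "'b::t2_space \<Rightarrow> 'c::t2_space" and L :: "'a::t2_space \<Rightarrow> 'b"
  assumes "continuous_on U h" "open U" "isCont L s" "L s \<in> U"
  shows "isCont (\<lambda>s. h (L s)) s"
  using assms by (intro isCont_o2[OF assms(3)]) (simp add: continuous_on_eq_continuous_at)

text \<open>Let \<open>h\<close> be the inverse of \<open>f\<close> over a generic set \<open>G \<noteq> 0\<close>. Multiplying \<open>X \<circ> h\<close> by the leading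
  coefficient of its algebraic equation makes it locally bounded, and the factor \<open>G\<^sup>2\<close> then makes the
  extension by \<open>0\<close> entire in each variable, hence a polynomial by Liouville.\<close>

lemma generically_injective_imp_rational:
  assumes "poly_map2 f" "dominant f" "generic_fibre_card f 1" "poly2 X"
  shows "\<exists>A B. poly2 A \<and> poly2 B \<and> (\<exists>q. B q \<noteq> 0) \<and> (\<forall>z. A (f z) = X z * B (f z))"
proof -
  obtain g where g: "poly2 g" "\<exists>q. g q \<noteq> 0" "\<And>q. g q \<noteq> 0 \<Longrightarrow> card (f -` {q}) = 1"
    using assms(3) unfolding generic_fibre_card_def by blast
  obtain n c e where c: "\<And>i. i \<le> n \<Longrightarrow> poly2 (c i)" "\<exists>q. c n q \<noteq> 0" "n > 0"
    "\<And>z. (\<Sum>i\<le>n. c i (f z) * X z ^ i) = 0"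
    and e: "poly2 e" "\<exists>q. e q \<noteq> 0"
    "\<And>z. e (f z) \<noteq> 0 \<Longrightarrow> (\<Sum>i\<le>n. c i (f z) * (of_nat i * X z ^ (i - 1))) \<noteq> 0"
    by (rule separable_algebraic_relation[OF assms(1,2,4)]) blast
  obtain n1 c1 where c1: "\<And>i. i \<le> n1 \<Longrightarrow> poly2 (c1 i)" "\<exists>q. c1 n1 q \<noteq> 0" "n1 > 0"
    "\<And>z. (\<Sum>i\<le>n1. c1 i (f z) * fst z ^ i) = 0"
    by (rule minimal_algebraic_relation[OF assms(1,2) poly2_fst]) blast
  obtain n2 c2 where c2: "\<And>i. i \<le> n2 \<Longrightarrow> poly2 (c2 i)" "\<exists>q. c2 n2 q \<noteq> 0" "n2 > 0"
    "\<And>z. (\<Sum>i\<le>n2. c2 i (f z) * snd z ^ i) = 0"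
    by (rule minimal_algebraic_relation[OF assms(1,2) poly2_snd]) blast
  \<comment> \<open>Where \<open>G\<close> does not vanish, the fibre is a single point,
    \<open>X\<close> is a simple root of its relation, and the relations for both coordinates have
    nonzero leading coefficients, so that the inverse is locally bounded.\<close>
  define G where "G = (\<lambda>q. g q * (e q * (c1 n1 q * c2 n2 q)))"
  have "poly2 G" unfolding G_def using g(1) e(1) c1(1) c2(1) by (intro poly2_mult) auto
  have "\<exists>q. G q \<noteq> 0" unfolding G_def using g e c1 c2
    by (intro poly2_mult_nonzero poly2_mult) auto
  define U where "U = {q. G q \<noteq> 0}"
  have "open U" unfolding U_def using \<open>poly2 G\<close>
    by (intro open_Collect_neq continuous_on_poly2[where u = "\<lambda>z. z"]) auto
  define h where "h = (\<lambda>q. THE z. f z = q)"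
  have "\<exists>!z. f z = q" if "q \<in> U" for q
  proof -
    have "card (f -` {q}) = 1" using that g(3) by (auto simp: U_def G_def)
    then obtain z where "f -` {q} = {z}" by (auto simp: card_1_singleton_iff)
    then have "f w = q \<longleftrightarrow> w = z" for w by (simp add: set_eq_iff)
    then show ?thesis by simp
  qed
  then have h: "f (h q) = q" "f z = q \<Longrightarrow> h q = z" if "q \<in> U" for q z
    using theI'[of "\<lambda>z. f z = q"] the1_equality[of "\<lambda>z. f z = q"] that unfolding h_def by blast+

  \<comment> \<open>On a compact subset of \<open>U\<close> the leading coefficient has no zero, so
    the root bound may be divided by it and stays bounded.\<close>
  have bnd: "bounded ((\<lambda>q. Y (h q)) ` K)"
    if d: "\<And>i. i \<le> m \<Longrightarrow> poly2 (d i)" "m > 0" "\<And>z. (\<Sum>i\<le>m. d i (f z) * Y z ^ i) = 0"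
      "\<And>q. q \<in> U \<Longrightarrow> d m q \<noteq> 0" and K: "compact K" "K \<subseteq> U" for m d K and Y :: "_ \<Rightarrow> complex"
  proof -
    define M where "M = (\<lambda>q. (1 + (\<Sum>i<m. norm (d i q * d m q ^ (m - 1 - i)))) / norm (d m q))"
    have cont: "continuous_on K (d i)" if "i \<le> m" for i
      using continuous_on_poly2[OF d(1)[OF that] continuous_on_id] .
    have "continuous_on K M" unfolding M_def using d(4) K(2) by (intro continuous_intros cont) auto
    then have "compact (M ` K)" using K(1) by (rule compact_continuous_image)
    then obtain R where R: "\<And>q. q \<in> K \<Longrightarrow> norm (M q) \<le> R"
      using compact_imp_bounded bounded_iff by (metis image_eqI)
    have "norm (Y (h q)) \<le> R" if "q \<in> K" for q
    proof -
      have "q \<in> U" using that K by blast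
      then have "(\<Sum>i\<le>m. d i q * Y (h q) ^ i) = 0" using d(3)[of "h q"] h(1) by simp
      then have "norm (d m q * Y (h q)) \<le> 1 + (\<Sum>i<m. norm (d i q * d m q ^ (m - 1 - i)))"
        using d(2) by (rule leading_coeff_times_root_bound)
      then have "norm (Y (h q)) \<le> M q"
        unfolding M_def using d(4)[OF \<open>q \<in> U\<close>] by (simp add: field_simps norm_mult)
      also have "\<dots> \<le> R" using R[OF that] by simp
      finally show ?thesis .
    qed
    then show ?thesis unfolding bounded_iff by blast
  qed

  have "continuous_on U h"
  proof (rule inverse_continuous_on_locally_bounded[OF continuous_on_poly_map2[OF assms(1)] \<open>open U\<close>])
    fix K assume K: "compact K" "K \<subseteq> U"
    have "bounded ((\<lambda>q. fst (h q)) ` K)"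
      using c1 K by (intro bnd[of n1 c1 fst K]) (auto simp: U_def G_def)
    moreover have "bounded ((\<lambda>q. snd (h q)) ` K)"
      using c2 K by (intro bnd[of n2 c2 snd K]) (auto simp: U_def G_def)
    ultimately have "bounded (((\<lambda>q. fst (h q)) ` K) \<times> ((\<lambda>q. snd (h q)) ` K))"
      by (rule bounded_Times)
    then show "bounded (h ` K)"
      by (rule bounded_subset) (simp add: image_subset_iff mem_Times_iff)
  qed (use h in auto)
  define t where "t = (\<lambda>q. X (h q))"
  have "continuous_on U t" unfolding t_def using assms(4) \<open>continuous_on U h\<close> by (rule continuous_on_poly2)
  have root: "(\<Sum>i\<le>n. c i q * t q ^ i) = 0" if "q \<in> U" for q
    using c(4)[of "h q"] h(1)[OF that] by (simp add: t_def)
  have simple: "(\<Sum>i\<le>n. c i q * (of_nat i * t q ^ (i - 1))) \<noteq> 0" if "q \<in> U" for q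
  proof -
    have "e (f (h q)) \<noteq> 0" using that h(1)[OF that] by (auto simp: U_def G_def)
    then show ?thesis using e(3)[of "h q"] h(1)[OF that] by (simp add: t_def)
  qed
  define M where "M = (\<lambda>q. 1 + (\<Sum>i<n. norm (c i q * c n q ^ (n - 1 - i))))"
  define W where "W = (\<lambda>q. G q ^ 2 * (c n q * t q))"
  \<comment> \<open>Outside \<open>U\<close> the value of \<open>h\<close>, hence of
    \<open>t\<close>, is unspecified, but the factor \<open>G q ^ 2\<close> makes \<open>W q\<close>
    equal to 0.\<close>
  have Wbound: "norm (W q) \<le> norm (G q) ^ 2 * M q" for q
  proof (cases "q \<in> U")
    case True
    have "norm (c n q * t q) \<le> M q"
      unfolding M_def using root[OF True] c(3) by (rule leading_coeff_times_root_bound)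
    then show ?thesis
      unfolding W_def norm_mult[of "G q ^ 2"] norm_power by (intro mult_left_mono) auto
  next
    case False
    then show ?thesis by (simp add: W_def U_def)
  qed

  \<comment> \<open>Stated for a general curve \<open>L\<close> along which polynomials restrict to
    polynomials, so that it applies to both coordinate directions.\<close>
  have holo: "(\<lambda>s. W (L s)) holomorphic_on UNIV"
    if L: "continuous_on UNIV L" "\<And>P. poly2 P \<Longrightarrow> \<exists>p. \<forall>s. P (L s) = poly p s" for L
  proof -
    obtain pG where pG: "\<And>s. G (L s) = poly pG s" using L(2)[OF \<open>poly2 G\<close>] by blast
    have "\<forall>i. \<exists>p. i \<le> n \<longrightarrow> (\<forall>s. c i (L s) = poly p s)" using L(2) c(1) by blast
    then obtain pc where pc: "\<And>i s. i \<le> n \<Longrightarrow> c i (L s) = poly (pc i) s" by metis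
    have "(\<lambda>s. W (L s)) field_differentiable at s0" for s0
    proof (cases "L s0 \<in> U")
      case True
      have "isCont L s0" using L(1) by (simp add: continuous_on_eq_continuous_at)
      have "open (L -` U)" using \<open>open U\<close> L(1) by (simp add: open_vimage)
      have "(\<lambda>s. t (L s)) field_differentiable at s0"
      proof (rule continuous_simple_root_differentiable)
        show "isCont (\<lambda>s. t (L s)) s0"
          using \<open>continuous_on U t\<close> \<open>open U\<close> \<open>isCont L s0\<close> True by (rule isCont_on_line)
        show "(\<Sum>i\<le>n. poly (pc i) s * t (L s) ^ i) = 0" if "s \<in> L -` U" for s
          using root[of "L s"] that by (simp add: pc)
        show "(\<Sum>i\<le>n. poly (pc i) s0 * (of_nat i * t (L s0) ^ (i - 1))) \<noteq> 0"
          using simple[OF True] by (simp add: pc)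
      qed (use \<open>open (L -` U)\<close> True in auto)
      moreover have "poly p field_differentiable at s0" for p :: "complex poly"
        unfolding field_differentiable_def using poly_DERIV by blast
      ultimately have "(\<lambda>s. poly pG s ^ 2 * (poly (pc n) s * t (L s))) field_differentiable at s0"
        by (intro field_differentiable_mult field_differentiable_power)
      then show ?thesis by (simp add: W_def pG pc)
    next
      case False
      then have "G (L s0) = 0" by (simp add: U_def)
      then have "poly pG s0 = 0" by (simp add: pG)
      \<comment> \<open>The zero of \<open>pG\<close> yields a factor \<open>s - s0\<close>; the
        square in \<open>W\<close> then gives the quadratic bound.\<close>
      then obtain r where r: "pG = [:- s0, 1:] * r" by (meson dvdE poly_eq_0_iff_dvd)
      show ?thesis
      proof (rule differentiable_of_quadratic_bound)
        show "W (L s0) = 0" using \<open>G (L s0) = 0\<close> by (simp add: W_def)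
        have "M (L s) = 1 + (\<Sum>i<n. norm (poly (pc i) s * poly (pc n) s ^ (n - 1 - i)))" for s
          by (simp add: M_def pc)
        then show "isCont (\<lambda>s. norm (poly r s) ^ 2 * M (L s)) s0"
          by (simp only:) (intro continuous_intros)
        show "norm (W (L s)) \<le> norm (s - s0) ^ 2 * (norm (poly r s) ^ 2 * M (L s))" for s
        proof -
          have "norm (G (L s)) = norm (s - s0) * norm (poly r s)"
            unfolding pG r by (simp add: norm_mult[symmetric] algebra_simps)
          then show ?thesis using Wbound[of "L s"] by (simp add: power_mult_distrib mult.assoc)
        qed
      qed
    qed
    then show ?thesis by (simp add: holomorphic_on_def field_differentiable_at_within)
  qed

  \<comment> \<open>The summands of \<open>G\<^sup>2 * M\<close> as polynomials; the index
    \<open>n\<close> stands for the summand 1 in \<open>M\<close>.\<close>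
  define Q where "Q = (\<lambda>i q. if i < n then G q ^ 2 * (c i q * c n q ^ (n - 1 - i)) else G q ^ 2)"
  have "poly2 (Q i)" for i
    using \<open>poly2 G\<close> c(1) by (cases "i < n") (auto simp: Q_def intro!: poly2_mult poly2_power)
  then obtain C N where C: "C \<ge> 0"
    "\<And>a b. (\<Sum>i\<le>n. norm (Q i (a, b))) \<le> C * (1 + norm a) ^ N * (1 + norm b) ^ N"
    using sum_poly2_growth[of "{..n}" Q] by blast
  have "norm (G q) ^ 2 * M q = (\<Sum>i\<le>n. norm (Q i q))" for q
    by (simp add: Q_def M_def lessThan_Suc_atMost[symmetric] norm_mult norm_power sum_distrib_left
        distrib_left)
  then have growth: "norm (W (a, b)) \<le> C * (1 + norm a) ^ N * (1 + norm b) ^ N" for a b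
    using order_trans[OF Wbound[of "(a, b)"]] C(2)[of a b] by simp
  have "poly2 W"
  proof (rule separately_polynomial_imp_poly2[of N])
    show "\<exists>p. degree p \<le> N \<and> (\<forall>a. W (a, b) = poly p a)" for b
    proof (rule entire_of_poly_growth_eq_poly[where C = "C * (1 + norm b) ^ N"])
      show "(\<lambda>a. W (a, b)) holomorphic_on UNIV"
        using poly2_on_line(1) by (intro holo continuous_intros) auto
      show "norm (W (s, b)) \<le> C * (1 + norm b) ^ N * (1 + norm s) ^ N" for s
        using growth[of s b] by (simp add: mult_ac)
    qed
    show "\<exists>p. \<forall>b. W (a, b) = poly p b" for a
    proof -
      have "\<exists>p. degree p \<le> N \<and> (\<forall>b. W (a, b) = poly p b)"
      proof (rule entire_of_poly_growth_eq_poly[where C = "C * (1 + norm a) ^ N"])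
        show "(\<lambda>b. W (a, b)) holomorphic_on UNIV"
          using poly2_on_line(2) by (intro holo continuous_intros) auto
        show "norm (W (a, s)) \<le> C * (1 + norm a) ^ N * (1 + norm s) ^ N" for s
          using growth[of a s] by (simp add: mult_ac)
      qed
      then show ?thesis by blast
    qed
  qed
  moreover have "poly2 (\<lambda>q. G q ^ 2 * c n q)"
    using \<open>poly2 G\<close> c(1) by (intro poly2_mult poly2_power) auto
  moreover have "\<exists>q. G q ^ 2 * c n q \<noteq> 0"
    using poly2_mult_nonzero[OF poly2_power[OF \<open>poly2 G\<close>, of 2] c(1)[of n]] \<open>\<exists>q. G q \<noteq> 0\<close> c(2) by simp
  moreover have "W (f z) = X z * (G (f z) ^ 2 * c n (f z))" for z
  proof (cases "f z \<in> U")
    case True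
    then have "t (f z) = X z" using h(2) by (simp add: t_def)
    then show ?thesis by (simp add: W_def)
  qed (simp add: W_def U_def)
  ultimately show ?thesis by (intro exI[of _ W] exI[of _ "\<lambda>q. G q ^ 2 * c n q"]) blast
qed

subsection \<open>Zeros of the denominator\<close>

text \<open>Bezout over the fraction field with denominators cleared. By pseudo-division, a nonzero
  element \<open>M\<close> of least degree in the ideal of \<open>A\<close> and \<open>B\<close>
  divides constant multiples of both; coprimality then makes \<open>M\<close> divide a nonzero
  constant. Over C[x], the constant \<open>r\<close> is a polynomial in \<open>x\<close> that
  vanishes at the first coordinate of every common zero.\<close>

lemma coprime_poly_combination_const:
  fixes A B :: "'a::{factorial_ring_gcd, semiring_gcd_mult_normalize} poly"
  assumes "coprime A B"
  shows "\<exists>U V r. r \<noteq> 0 \<and> U * A + V * B = [:r:]"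
proof -
  define I where "I = {M. \<exists>U V. M = U * A + V * B}"
  have "A = 1 * A + 0 * B" "B = 0 * A + 1 * B" by simp_all
  then have AI: "A \<in> I" and BI: "B \<in> I" unfolding I_def by blast+
  \<comment> \<open>If \<open>A = 0\<close>, coprimality makes \<open>B\<close> a unit, hence
    nonzero.\<close>
  have "\<exists>M. M \<in> I \<and> M \<noteq> 0" using AI BI assms by (cases "A = 0") auto
  then obtain M where M: "M \<in> I" "M \<noteq> 0" and min: "\<And>M'. M' \<in> I \<and> M' \<noteq> 0 \<Longrightarrow> degree M \<le> degree M'"
    using ex_has_least_nat[of "\<lambda>M. M \<in> I \<and> M \<noteq> 0" _ degree] by blast
  have div: "\<exists>a. a \<noteq> 0 \<and> M dvd smult a H" if "H \<in> I" for H
  proof -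
    obtain a Q where aQ: "a \<noteq> 0" "smult a H = M * Q + pseudo_mod H M"
      using pseudo_mod(1)[OF M(2), of H] by blast
    have "pseudo_mod H M = smult a H - M * Q" using aQ by simp
    moreover obtain U V U' V' where "H = U * A + V * B" "M = U' * A + V' * B"
      using \<open>H \<in> I\<close> M(1) unfolding I_def by blast
    ultimately have "pseudo_mod H M = (smult a U - U' * Q) * A + (smult a V - V' * Q) * B"
      by (simp add: algebra_simps smult_add_right)
    then have "pseudo_mod H M \<in> I" unfolding I_def by blast
    then have "pseudo_mod H M = 0" using pseudo_mod(2)[OF M(2), of H] min leD by blast
    then show ?thesis using aQ by auto
  qed
  obtain a b where ab: "a \<noteq> 0" "M dvd smult a A" "b \<noteq> 0" "M dvd smult b B"
    using div[OF AI] div[OF BI] by blast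
  have "M dvd [:a * b:] * A" using dvd_smult[OF ab(2), of b] by (simp add: mult.commute)
  moreover have "M dvd [:a * b:] * B" using dvd_smult[OF ab(4), of a] by simp
  ultimately have "M dvd gcd ([:a * b:] * A) ([:a * b:] * B)" by (rule gcd_greatest)
  moreover have "gcd A B = 1" using assms by (simp add: coprime_iff_gcd_eq_1)
  ultimately have "M dvd [:a * b:]" unfolding gcd_mult_left by simp
  then have "degree M \<le> 0" using ab dvd_imp_degree_le[of M "[:a * b:]"] by simp
  then obtain r where "M = [:r:]" using degree_0_id[of M] by (metis le_zero_eq)
  moreover obtain U V where "M = U * A + V * B" using M(1) unfolding I_def by blast
  ultimately show ?thesis using M(2) by (intro exI[of _ U] exI[of _ V] exI[of _ r]) auto
qed

text \<open>If the polynomial over a nearby \<open>a\<close> had no zero in the disc around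
  \<open>b0\<close>, its reciprocal would be holomorphic there. The maximum principle would then
  bound the reciprocal at \<open>b0\<close> by its boundary values, whereas the polynomial is close
  to 0 at \<open>b0\<close> and not on the circle. The value at \<open>b1\<close> ensures that the
  polynomial over \<open>a0\<close> is not identically zero.\<close>

lemma poly_root_persists:
  assumes "bieval F (a0, b0) = 0" "bieval F (a0, b1) \<noteq> 0" "e > 0"
  shows "\<forall>\<^sub>F a in nhds a0. \<exists>b\<in>ball b0 e. bieval F (a, b) = 0"
proof -
  obtain p where p: "\<And>b. bieval F (a0, b) = poly p b" using poly2_on_line(2)[OF poly2_bieval] by blast
  define Z where "Z = {b. poly p b = 0}"
  have "p \<noteq> 0" using assms(2) p by auto
  then have "finite (dist b0 ` Z)" unfolding Z_def by (intro finite_imageI poly_roots_finite)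
  \<comment> \<open>Only finitely many radii are distances from \<open>b0\<close> to a root, so some
    circle of radius below \<open>e\<close> carries no root.\<close>
  then have "infinite ({0<..<e} - dist b0 ` Z)" using assms(3) infinite_Ioo by (intro Diff_infinite_finite) auto
  then obtain r where "r \<in> {0<..<e} - dist b0 ` Z" using infinite_imp_nonempty by blast
  then have r: "0 < r" "r < e" "\<And>b. b \<in> sphere b0 r \<Longrightarrow> poly p b \<noteq> 0" by (auto simp: Z_def)
  have "continuous_on (sphere b0 r) (\<lambda>b. norm (poly p b))" by (intro continuous_intros)
  then obtain bm where bm: "bm \<in> sphere b0 r" "\<And>b. b \<in> sphere b0 r \<Longrightarrow> norm (poly p bm) \<le> norm (poly p b)"
    using continuous_attains_inf[OF compact_sphere, of b0 r "\<lambda>b. norm (poly p b)"] r(1) by fastforce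
  define \<mu> where "\<mu> = norm (poly p bm)"
  have \<mu>: "\<mu> > 0" using r(3)[OF bm(1)] by (simp add: \<mu>_def)
  define K where "K = cball a0 1 \<times> cball b0 r"
  have "compact K" unfolding K_def by (intro compact_Times compact_cball)
  moreover have "continuous_on K (bieval F)"
    using continuous_on_poly2[OF poly2_bieval continuous_on_id] .
  ultimately have "uniformly_continuous_on K (bieval F)" by (intro compact_uniformly_continuous)
  then obtain d where d: "d > 0"
    "\<And>q q'. q \<in> K \<Longrightarrow> q' \<in> K \<Longrightarrow> dist q' q < d \<Longrightarrow> dist (bieval F q') (bieval F q) < \<mu> / 2"
    using \<mu> unfolding uniformly_continuous_on_def by (meson half_gt_zero)
  have "\<exists>b\<in>ball b0 e. bieval F (a, b) = 0" if a: "dist a a0 < min d 1" for a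
  proof (rule ccontr)
    assume neg: "\<not> ?thesis"
    have close: "dist (bieval F (a, b)) (poly p b) < \<mu> / 2" if "b \<in> cball b0 r" for b
      unfolding p[symmetric] using a that by (intro d(2)) (auto simp: K_def dist_Pair_Pair dist_commute)
    obtain pa where pa: "\<And>b. bieval F (a, b) = poly pa b" using poly2_on_line(2)[OF poly2_bieval] by blast
    have nz: "poly pa b \<noteq> 0" if "b \<in> cball b0 r" for b
      using neg that r(2) by (auto simp: pa)
    have "norm (inverse (poly pa b0)) \<le> 2 / \<mu>"
    proof (rule maximum_modulus_frontier[of "\<lambda>b. inverse (poly pa b)" "cball b0 r"])
      show "(\<lambda>b. inverse (poly pa b)) holomorphic_on interior (cball b0 r)"
        using nz by (intro holomorphic_intros) auto
      show "continuous_on (closure (cball b0 r)) (\<lambda>b. inverse (poly pa b))"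
        using nz by (intro continuous_intros) auto
      fix b assume "b \<in> frontier (cball b0 r)"
      then have b: "b \<in> sphere b0 r" "b \<in> cball b0 r" by auto
      have "\<mu> \<le> norm (poly p b)" using bm(2)[OF b(1)] by (simp add: \<mu>_def)
      then have "\<mu> / 2 \<le> norm (poly pa b)"
        using close[OF b(2)] norm_triangle_ineq3[of "poly pa b" "poly p b"] by (simp add: pa dist_norm)
      then show "norm (inverse (poly pa b)) \<le> 2 / \<mu>"
        unfolding norm_inverse using \<mu> nz[OF b(2)] by (simp add: field_simps)
    qed (use r in auto)
    moreover have "norm (poly pa b0) < \<mu> / 2"
      using close[of b0] r(1) assms(1) by (simp add: pa p)
    moreover have "poly pa b0 \<noteq> 0" using nz r(1) by simp
    ultimately show False unfolding norm_inverse using \<mu> by (simp add: field_simps)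
  qed
  moreover have "\<forall>\<^sub>F a in nhds a0. dist a a0 < min d 1"
    using d(1) by (intro eventually_nhds_metric[THEN iffD2] exI[of _ "min d 1"]) auto
  ultimately show ?thesis by (auto elim: eventually_mono)
qed

text \<open>\<open>[:[:- a, 1:]:]\<close> is \<open>x - a\<close>, constant in the outer variable;
  all coefficients of \<open>F\<close> vanish at \<open>a\<close>, so it divides each of
  them.\<close>

lemma bieval_vertical_line_zero_imp_dvd:
  assumes "\<And>b. bieval F (a, b) = 0"
  shows "[:[:- a, 1:]:] dvd F"
proof -
  define p where "p = map_poly (\<lambda>c. poly c a) F"
  have "poly p b = bieval F (a, b)" for b
    unfolding p_def bieval_def by (induction F) (auto simp: map_poly_pCons)
  then have "p = 0" using assms poly_all_0_iff_0 by auto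
  then have "poly (coeff F j) a = 0" for j
    using coeff_map_poly[of "\<lambda>c. poly c a" F j] by (simp add: p_def)
  then show ?thesis by (simp add: const_poly_dvd_iff poly_eq_0_iff_dvd)
qed

text \<open>If \<open>B\<close> vanishes on the vertical line through \<open>p\<close>, then
  \<open>A\<close> does not, as \<open>x - a0\<close> would be a common factor, and almost every
  point of that line will do. Otherwise zeros of \<open>B\<close> persist over every first
  coordinate near \<open>a0\<close>, and the Bezout identity shows that all but finitely many first
  coordinates admit no common zero.\<close>

lemma coprime_zero_nearby:
  assumes "coprime A B" "bieval B p = 0" "e > 0"
  shows "\<exists>q\<in>ball p e. q \<noteq> p \<and> bieval B q = 0 \<and> bieval A q \<noteq> 0"
proof -
  obtain a0 b0 where p: "p = (a0, b0)" by force
  show ?thesis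
  proof (cases "\<forall>b. bieval B (a0, b) = 0")
    case True
    obtain pA where pA: "\<And>b. bieval A (a0, b) = poly pA b" using poly2_on_line(2)[OF poly2_bieval] by blast
    have "pA \<noteq> 0"
    proof
      assume "pA = 0"
      then have "[:[:- a0, 1:]:] dvd A" by (intro bieval_vertical_line_zero_imp_dvd) (simp add: pA)
      moreover have "[:[:- a0, 1:]:] dvd B" using True by (intro bieval_vertical_line_zero_imp_dvd) simp
      ultimately have "[:[:- a0, 1:]:] dvd 1" using assms(1) coprime_common_divisor by blast
      then show False by (simp add: is_unit_const_poly_iff is_unit_iff_degree)
    qed
    then have "infinite (ball b0 e - ({b. poly pA b = 0} \<union> {b0}))"
      using assms(3) by (intro Diff_infinite_finite infinite_ball_complex) (auto intro: poly_roots_finite)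
    then obtain b where "b \<in> ball b0 e - ({b. poly pA b = 0} \<union> {b0})" 
      using infinite_imp_nonempty by blast
    then show ?thesis using True
      by (intro bexI[of _ "(a0, b)"]) (auto simp: p pA dist_Pair_Pair)
  next
    case False
    then obtain b1 where b1: "bieval B (a0, b1) \<noteq> 0" by blast
    obtain U V r where r: "r \<noteq> 0" "U * A + V * B = [:r:]"
      using coprime_poly_combination_const[OF assms(1)] by blast
    \<comment> \<open>The first coordinates, apart from \<open>a0\<close>, over which
      \<open>A\<close> and \<open>B\<close> may vanish together.\<close>
    define Z where "Z = {a. poly r a = 0} - {a0}"
    have "finite Z" unfolding Z_def using r(1) by (intro finite_Diff poly_roots_finite)
    then have "open (- Z)" by (simp add: finite_imp_closed open_Compl)
    then have "\<forall>\<^sub>F a in at a0. a \<in> - Z" by (rule eventually_at_in_open') (simp add: Z_def)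
    moreover have "\<forall>\<^sub>F a in at a0. \<exists>b\<in>ball b0 (e / 2). bieval B (a, b) = 0"
      using poly_root_persists[OF _ b1, of b0 "e / 2"] assms(2,3)
      by (auto simp: p eventually_at_filter elim: eventually_mono)
    moreover have "\<forall>\<^sub>F a in at a0. a \<in> ball a0 (e / 2)"
      using assms(3) by (intro eventually_at_in_open') auto
    moreover have "\<forall>\<^sub>F a in at a0. a \<noteq> a0" by (rule eventually_neq_at_within)
    ultimately have "\<forall>\<^sub>F a in at a0. a \<in> - Z \<and> (\<exists>b\<in>ball b0 (e / 2). bieval B (a, b) = 0) \<and>
        a \<in> ball a0 (e / 2) \<and> a \<noteq> a0"
      by eventually_elim blast
    then obtain a b where ab: "a \<in> - Z" "b \<in> ball b0 (e / 2)" "bieval B (a, b) = 0"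
      "a \<in> ball a0 (e / 2)" "a \<noteq> a0"
      using eventually_happens'[OF at_neq_bot] by blast
    have "bieval (U * A + V * B) (a, b) \<noteq> 0" unfolding r(2) using ab(1,5) by (simp add: Z_def)
    then have "bieval A (a, b) \<noteq> 0" using ab(3) by auto
    moreover have "dist p (a, b) < e"
    proof -
      have "dist p (a, b) \<le> dist a0 a + dist b0 b"
        unfolding p dist_Pair_Pair by (rule sqrt_sum_squares_le_sum) auto
      then show ?thesis using ab(2,4) by simp
    qed
    ultimately show ?thesis using ab(3,5) by (intro bexI[of _ "(a, b)"]) (auto simp: p)
  qed
qed

text \<open>In lowest terms, a zero of the denominator at which the numerator does not vanish cannot be a
  value of \<open>f\<close>; such zeros accumulate at every zero of the denominator.\<close>

lemma isolated_point_regular: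
  assumes f: "poly_map2 f" "dominant f" "generic_fibre_card f 1" and X: "poly2 X"
    and iso: "isolated_point_of p (UNIV - range f)"
  shows "\<exists>A B. poly2 A \<and> poly2 B \<and> B p \<noteq> 0 \<and> (\<forall>z. A (f z) = X z * B (f z))"
proof -
  obtain A B where "poly2 A" "poly2 B" and nz: "\<exists>q. B q \<noteq> 0" and AB: "\<And>z. A (f z) = X z * B (f z)"
    using generically_injective_imp_rational[OF f X] by blast
  then obtain F H where FH: "A = bieval F" "B = bieval H" using poly2D by metis
  have "H \<noteq> 0" using nz FH by auto
  then have "gcd F H \<noteq> 0" by simp
  then obtain F' H' where F': "F = F' * gcd F H" "H = H' * gcd F H" "coprime F' H'"
    using gcd_coprime_exists[of F H] by blast
  define D where "D = gcd F H"
  have "D \<noteq> 0" using \<open>gcd F H \<noteq> 0\<close> by (simp add: D_def)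
  \<comment> \<open>The relation survives division by the gcd \<open>D\<close>, since by dominance
    \<open>D\<close> composed with \<open>f\<close> is a nonzero polynomial and can be
    cancelled.\<close>
  have eq: "bieval F' (f z) = X z * bieval H' (f z)" for z
  proof -
    define Y where "Y = (\<lambda>z. bieval F' (f z) - X z * bieval H' (f z))"
    have "poly2 Y" unfolding Y_def
      by (intro poly2_diff poly2_mult X poly2_compose_map[OF poly2_bieval f(1)])
    have "\<exists>z. bieval D (f z) \<noteq> 0"
      using poly2_vanishing_on_range[OF poly2_bieval[of D] f(2)] bieval_eq_0_iff[of D] \<open>D \<noteq> 0\<close> by blast
    moreover have "bieval D (f z) * Y z = 0" for z
    proof -
      have "bieval F (f z) = bieval F' (f z) * bieval D (f z)"
        "bieval H (f z) = bieval H' (f z) * bieval D (f z)"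
        unfolding D_def using F'(1,2) bieval_mult by metis+
      then show ?thesis using AB[of z] by (simp add: FH Y_def algebra_simps)
    qed
    ultimately have "Y z = 0"
      using poly2_mult_nonzero[OF poly2_compose_map[OF poly2_bieval f(1), of D] \<open>poly2 Y\<close>] by blast
    then show ?thesis by (simp add: Y_def)
  qed
  have "bieval H' p \<noteq> 0"
  proof
    assume zero: "bieval H' p = 0"
    obtain e where e: "e > 0" "ball p e \<inter> (UNIV - range f) = {p}"
      using iso unfolding isolated_point_of_def by blast
    obtain q where q: "q \<in> ball p e" "q \<noteq> p" "bieval H' q = 0" "bieval F' q \<noteq> 0"
      using coprime_zero_nearby[OF F'(3) zero e(1)] by blast
    have "q \<in> range f" using e(2) q(1,2) by blast
    then obtain z where "q = f z" by blast
    then show False using eq[of z] q(3,4) by simp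
  qed
  then show ?thesis using eq poly2_bieval by blast
qed

text \<open>At an isolated point \<open>p\<close> both components of the rational inverse
  \<open>h\<close> are regular. Dominance provides values \<open>u n\<close> of \<open>f\<close>
  converging to \<open>p\<close>, where \<open>f (h (u n)) = u n\<close> eventually; in the limit
  \<open>f (h p) = p\<close>, so \<open>p\<close> is a value.\<close>

lemma generically_injective_no_isolated_point:
  assumes f: "poly_map2 f" "dominant f" "generic_fibre_card f 1"
  shows "\<not> isolated_point_of p (UNIV - range f)"
proof
  assume iso: "isolated_point_of p (UNIV - range f)"
  obtain A1 B1 where 1: "poly2 A1" "poly2 B1" "B1 p \<noteq> 0" "\<And>z. A1 (f z) = fst z * B1 (f z)"
    using isolated_point_regular[OF f poly2_fst iso] by blast
  obtain A2 B2 where 2: "poly2 A2" "poly2 B2" "B2 p \<noteq> 0" "\<And>z. A2 (f z) = snd z * B2 (f z)"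
    using isolated_point_regular[OF f poly2_snd iso] by blast
  define h where "h = (\<lambda>q. (A1 q / B1 q, A2 q / B2 q))"
  have cont: "isCont P p" if "poly2 P" for P
    using continuous_on_poly2[OF that continuous_on_id, of UNIV] by (simp add: continuous_on_eq_continuous_at)
  have "isCont h p" unfolding h_def using 1(3) 2(3) by (intro continuous_intros cont 1 2)
  moreover have "isCont f (h p)"
    using continuous_on_poly_map2[OF f(1), of UNIV] by (simp add: continuous_on_eq_continuous_at)
  ultimately have fh: "isCont (\<lambda>q. f (h q)) p" by (rule isCont_o2)
  have "p \<in> closure (range f)" using f(2) by (simp add: dominant_def)
  then obtain u where u: "\<And>n. u n \<in> range f" "u \<longlonglongrightarrow> p" unfolding closure_sequential by blast
  have "(\<lambda>n. B1 (u n)) \<longlonglongrightarrow> B1 p" "(\<lambda>n. B2 (u n)) \<longlonglongrightarrow> B2 p"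
    using isCont_tendsto_compose[OF cont u(2)] 1(2) 2(2) by blast+
  then have "\<forall>\<^sub>F n in sequentially. B1 (u n) \<noteq> 0" "\<forall>\<^sub>F n in sequentially. B2 (u n) \<noteq> 0"
    using 1(3) 2(3) tendsto_imp_eventually_ne by blast+
  then have "\<forall>\<^sub>F n in sequentially. f (h (u n)) = u n"
  proof eventually_elim
    case (elim n)
    obtain z where z: "u n = f z" using u(1)[of n] by blast
    have "h (u n) = z" using elim 1(4)[of z] 2(4)[of z] by (simp add: h_def z prod_eq_iff)
    then show ?case using z by simp
  qed
  then have "(\<lambda>n. f (h (u n))) \<longlonglongrightarrow> p" using u(2) by (simp add: tendsto_cong)
  then have "f (h p) = p" using isCont_tendsto_compose[OF fh u(2)] LIMSEQ_unique by blast
  then have "p \<in> range f" by (metis rangeI)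
  then show False using iso by (simp add: isolated_point_of_def)
qed

subsection \<open>A map omitting an isolated point\<close>

lemma card_roots_rsquarefree:
  fixes p :: "complex poly"
  assumes "rsquarefree p"
  shows "card {z. poly p z = 0} = degree p"
proof -
  have "p \<noteq> 0" using assms by (auto simp: rsquarefree_def)
  have "degree p = degree (smult (lead_coeff p) (\<Prod>z | poly p z = 0. [:- z, 1:]))"
    using complex_poly_decompose_rsquarefree[OF assms] by simp
  also have "\<dots> = degree (\<Prod>z | poly p z = 0. [:- z, 1:])" using \<open>p \<noteq> 0\<close> by simp
  also have "\<dots> = (\<Sum>z | poly p z = 0. degree [:- z, 1:])" by (rule degree_prod_sum_eq) simp
  finally show ?thesis by simp
qed

definition omitting_map :: "nat \<Rightarrow> complex \<times> complex \<Rightarrow> complex \<times> complex" where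
  "omitting_map k z = (fst z * snd z - 1, fst z + (fst z * snd z - 1) * snd z ^ k)"

text \<open>On the fibre over \<open>(a, b)\<close> one has \<open>y = (1 + a) / x\<close>; this is the resulting equation for \<open>x\<close>.\<close>

definition fibre_poly :: "nat \<Rightarrow> complex \<Rightarrow> complex \<Rightarrow> complex poly" where
  "fibre_poly k a b = monom 1 k * [:- b, 1:] + [:a * (1 + a) ^ k:]"

lemma poly_fibre_poly: "poly (fibre_poly k a b) x = x ^ k * (x - b) + a * (1 + a) ^ k"
  by (simp add: fibre_poly_def poly_monom algebra_simps)

lemma degree_fibre_poly: "degree (fibre_poly k a b) = k + 1"
proof -
  have "degree (monom 1 k * [:- b, 1:]) = degree (monom (1::complex) k) + degree [:- b, 1:]"
    by (rule degree_mult_eq) auto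
  then have "degree (monom 1 k * [:- b, 1:]) = k + 1" by (simp add: degree_monom_eq del: mult_pCons_right)
  then show ?thesis unfolding fibre_poly_def by (subst degree_add_eq_left) simp_all
qed

text \<open>On the fibre \<open>x * y = 1 + a\<close> is nonzero, so \<open>x\<close> may be
  inverted, \<open>y\<close> eliminated, and the second equation multiplied by \<open>x ^ k\<close>.
  Conversely no root is 0, because for \<open>k \<ge> 1\<close> the value there is
  \<open>a * (1 + a) ^ k\<close>.\<close>

lemma omitting_map_fibre:
  assumes "k \<ge> 1" "a * (1 + a) \<noteq> 0"
  shows "omitting_map k -` {(a, b)} = (\<lambda>x. (x, (1 + a) / x)) ` {x. poly (fibre_poly k a b) x = 0}"
proof -
  have a: "a \<noteq> 0" "1 + a \<noteq> 0" using assms(2) by auto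
  have eq: "x + a * ((1 + a) / x) ^ k = b \<longleftrightarrow> poly (fibre_poly k a b) x = 0" if "x \<noteq> 0" for x
  proof -
    have "x ^ k * ((1 + a) / x) ^ k = (1 + a) ^ k" using that by (simp add: power_divide)
    then have "poly (fibre_poly k a b) x = x ^ k * (x - b) + a * (x ^ k * ((1 + a) / x) ^ k)"
      by (simp add: poly_fibre_poly)
    also have "\<dots> = x ^ k * (x + a * ((1 + a) / x) ^ k - b)" by (simp only: algebra_simps)
    finally show ?thesis using that by simp
  qed
  have root: "x \<noteq> 0" if "poly (fibre_poly k a b) x = 0" for x
    using that a assms(1) by (auto simp: poly_fibre_poly power_0_left)
  show ?thesis
  proof (intro set_eqI iffI)
    fix z assume "z \<in> omitting_map k -` {(a, b)}"
    moreover obtain x y where z: "z = (x, y)" by force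
    ultimately have "x * y - 1 = a" "x + a * y ^ k = b" by (auto simp: omitting_map_def)
    then have "x * y = 1 + a" by (simp add: algebra_simps)
    then have "x \<noteq> 0" using a(2) by auto
    then have "y = (1 + a) / x" using \<open>x * y = 1 + a\<close> by (simp add: field_simps)
    then show "z \<in> (\<lambda>x. (x, (1 + a) / x)) ` {x. poly (fibre_poly k a b) x = 0}"
      using eq[of x] \<open>x \<noteq> 0\<close> \<open>x + a * y ^ k = b\<close> z by auto
  next
    fix z assume "z \<in> (\<lambda>x. (x, (1 + a) / x)) ` {x. poly (fibre_poly k a b) x = 0}"
    then obtain x where x: "z = (x, (1 + a) / x)" "poly (fibre_poly k a b) x = 0" by blast
    then show "z \<in> omitting_map k -` {(a, b)}"
      using eq[of x] root[of x] by (simp add: omitting_map_def)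
  qed
qed

lemma omitting_map_range:
  assumes "k \<ge> 1" "a * (1 + a) \<noteq> 0"
  shows "(a, b) \<in> range (omitting_map k)"
proof -
  have "\<not> constant (poly (fibre_poly k a b))" by (simp add: constant_degree degree_fibre_poly)
  then obtain x where "poly (fibre_poly k a b) x = 0" using fundamental_theorem_of_algebra by blast
  then have "omitting_map k -` {(a, b)} \<noteq> {}" by (subst omitting_map_fibre[OF assms]) blast
  then obtain z where "omitting_map k z = (a, b)" by auto
  then show ?thesis by (metis rangeI)
qed

text \<open>The last factor is, up to sign, the discriminant of the fibre polynomial divided by its trivial
  factors: a double root satisfies \<open>(k + 1) * x = k * b\<close>.\<close>

lemma rsquarefree_fibre_poly:
  assumes "k \<ge> 1" "a * (1 + a) \<noteq> 0"
    "of_nat (k + 1) ^ (k + 1) * (a * (1 + a) ^ k) - of_nat k ^ k * b ^ (k + 1) \<noteq> 0"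
  shows "rsquarefree (fibre_poly k a b)"
  unfolding rsquarefree_roots
proof (intro allI notI)
  fix x assume x: "poly (fibre_poly k a b) x = 0 \<and> poly (pderiv (fibre_poly k a b)) x = 0"
  obtain m where m: "k = Suc m" using assms(1) by (cases k) auto
  have "x \<noteq> 0" using x assms(1,2) by (auto simp: poly_fibre_poly power_0_left)
  have "poly (pderiv (fibre_poly k a b)) x = x ^ m * (of_nat (k + 1) * x - of_nat k * b)"
    unfolding fibre_poly_def pderiv_add pderiv_mult poly_add poly_mult
    by (simp add: pderiv_monom poly_monom pderiv_pCons m algebra_simps)
  then have kx: "of_nat (k + 1) * x = of_nat k * b" using x \<open>x \<noteq> 0\<close> by simp
  define n :: complex where "n = of_nat (k + 1)"
  have "a * (1 + a) ^ k = x ^ k * (b - x)" using x by (simp add: poly_fibre_poly algebra_simps add_eq_0_iff)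
  \<comment> \<open>Scaling by \<open>n ^ (k + 1)\<close> lets \<open>n * x = of_nat k * b\<close>
    be substituted without division.\<close>
  then have "n ^ (k + 1) * (a * (1 + a) ^ k) = (n * x) ^ k * (n * (b - x))"
    by (simp add: power_mult_distrib mult_ac)
  also have "\<dots> = (n * x) ^ k * (n * b - n * x)" by (simp only: right_diff_distrib)
  also have "n * x = of_nat k * b" unfolding n_def by (rule kx)
  also have "n * b - of_nat k * b = b" by (simp add: n_def algebra_simps)
  also have "(of_nat k * b) ^ k * b = of_nat k ^ k * b ^ (k + 1)" by (simp add: power_mult_distrib)
  finally show False using assms(3) unfolding n_def by simp
qed

lemma poly_map2_omitting_map: "poly_map2 (omitting_map k)"
  unfolding poly_map2_def omitting_map_def fst_conv snd_conv
  by (intro conjI poly2_add poly2_diff poly2_mult poly2_power poly2_fst poly2_snd poly2_const)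

lemma dominant_omitting_map:
  assumes "k \<ge> 1"
  shows "dominant (omitting_map k)"
proof -
  define g :: "complex \<times> complex \<Rightarrow> complex" where "g = (\<lambda>q. fst q * (1 + fst q))"
  have "poly2 g" unfolding g_def by (intro poly2_mult poly2_add poly2_fst poly2_const)
  moreover have "g (1, 0) \<noteq> 0" by (simp add: g_def)
  ultimately have "closure {q. g q \<noteq> 0} = UNIV" by (intro poly2_nonzero_dense) blast+
  moreover have "{q. g q \<noteq> 0} \<subseteq> range (omitting_map k)"
  proof
    fix q assume "q \<in> {q. g q \<noteq> 0}"
    then show "q \<in> range (omitting_map k)"
      using omitting_map_range[OF assms, of "fst q" "snd q"] by (simp add: g_def)
  qed
  ultimately show ?thesis unfolding dominant_def by (metis closure_mono top.extremum_uniqueI)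
qed

lemma generic_fibre_card_omitting_map:
  assumes "k \<ge> 1"
  shows "generic_fibre_card (omitting_map k) (k + 1)"
proof -
  \<comment> \<open>The first factor makes the description of the fibre valid, the second makes its
    \<open>k + 1\<close> roots distinct.\<close>
  define g :: "complex \<times> complex \<Rightarrow> complex" where
    "g = (\<lambda>q. (fst q * (1 + fst q)) * (of_nat (k + 1) ^ (k + 1) * (fst q * (1 + fst q) ^ k)
      - of_nat k ^ k * snd q ^ (k + 1)))"
  have "poly2 g" unfolding g_def
    by (intro poly2_diff poly2_add poly2_mult poly2_power poly2_fst poly2_snd poly2_const)
  moreover have "g (1, 0) \<noteq> 0" by (simp add: g_def del: of_nat_Suc)
  moreover have "finite (omitting_map k -` {q}) \<and> card (omitting_map k -` {q}) = k + 1" if "g q \<noteq> 0" for q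
  proof -
    obtain a b where q: "q = (a, b)" by force
    have a: "a * (1 + a) \<noteq> 0" and sf: "rsquarefree (fibre_poly k a b)"
      using that assms by (auto simp: g_def q intro!: rsquarefree_fibre_poly)
    have "finite {x. poly (fibre_poly k a b) x = 0}"
      using sf by (intro poly_roots_finite) (auto simp: rsquarefree_def)
    moreover have "card ((\<lambda>x. (x, (1 + a) / x)) ` {x. poly (fibre_poly k a b) x = 0}) = k + 1"
      by (subst card_image) (auto simp: inj_on_def card_roots_rsquarefree[OF sf] degree_fibre_poly)
    ultimately show ?thesis unfolding q omitting_map_fibre[OF assms a] by simp
  qed
  ultimately show ?thesis unfolding generic_fibre_card_def by blast
qed

text \<open>If the first component is 0, then \<open>x * y = 1\<close> and the second component is
  \<open>x\<close>, which is nonzero. Radius 1 suffices: it keeps \<open>a\<close> away from -1, and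
  points with \<open>a = 0\<close> have an explicit preimage.\<close>

lemma isolated_point_omitting_map:
  assumes "k \<ge> 1"
  shows "isolated_point_of (0, 0) (UNIV - range (omitting_map k))"
proof -
  have "omitting_map k z \<noteq> (0, 0)" for z by (auto simp: omitting_map_def)
  then have "(0, 0) \<notin> range (omitting_map k)" by (metis rangeE)
  moreover have "q \<in> range (omitting_map k)" if q: "q \<in> ball (0, 0) 1" "q \<noteq> (0, 0)" for q
  proof -
    obtain a b where ab: "q = (a, b)" by force
    have "norm a \<le> norm (a, b)" using norm_fst_le by blast
    also have "\<dots> < 1" using q(1) by (simp add: ab zero_prod_def[symmetric])
    finally have "1 + a \<noteq> 0" by (metis add.inverse_inverse add_eq_0_iff less_irrefl norm_minus_cancel norm_one)
    show ?thesis
    proof (cases "a = 0")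
      case True
      then have "b \<noteq> 0" using q ab by auto
      then have "omitting_map k (b, 1 / b) = q" by (simp add: omitting_map_def ab True)
      then show ?thesis by (metis rangeI)
    next
      case False
      then show ?thesis using omitting_map_range[OF assms, of a b] \<open>1 + a \<noteq> 0\<close> by (simp add: ab)
    qed
  qed
  ultimately show ?thesis unfolding isolated_point_of_def
    by (intro conjI exI[of _ 1]) auto
qed

theorem theorem1p5:
  fixes k :: nat
  shows "(\<exists>f. poly_map2 f \<and> dominant f \<and> generic_fibre_card f (k + 1) \<and>
            (\<exists>p. isolated_point_of p (UNIV - range f)))
         \<longleftrightarrow> k \<ge> 1"
proof
  assume "\<exists>f. poly_map2 f \<and> dominant f \<and> generic_fibre_card f (k + 1) \<and>
            (\<exists>p. isolated_point_of p (UNIV - range f))"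
  then show "k \<ge> 1"
    \<comment> \<open>For \<open>k = 0\<close> the generic fibre is a single point, the case just
      excluded.\<close>
    using generically_injective_no_isolated_point by (cases k) auto
next
  assume "k \<ge> 1"
  then show "\<exists>f. poly_map2 f \<and> dominant f \<and> generic_fibre_card f (k + 1) \<and>
            (\<exists>p. isolated_point_of p (UNIV - range f))"
    using poly_map2_omitting_map dominant_omitting_map generic_fibre_card_omitting_map
      isolated_point_omitting_map by blast
qed

end
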